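(* Let $q$ be a prime power with $q\equiv 3\pmod 4$, let $G=S_{q^2}$ be the symmetric group on the set $\mathbb{F}_q^2$, and let $H=\mathrm{AGL}_2(q)<G$ be the affine group acting naturally on $\mathbb{F}_q^2$. Then $H$ is a perfect code of $G$.
   Context: All groups are finite. For a group $G$ with identity $e$ and an inverse-closed subset $S\subseteq G\setminus\{e\}$, the Cayley graph $\mathrm{Cay}(G,S)$ has vertex set $G$ and edges $\{g,sg\}$ for $s\in S$, $g\in G$. A perfect code in a graph is an independent set $C$ of vertices such that every vertex outside $C$ is adjacent to exactly one vertex of $C$. A subgroup $H$ of $G$ is a perfect code of $G$ if some Cayley graph of $G$ admits $H$ as a perfect code. *)

theory Defs
  imports "HOL-Algebra.Bij"
begin

definition cayley_adj :: "('g, 'b) monoid_scheme \<Rightarrow> 'g set \<Rightarrow> 'g \<Rightarrow> 'g \<Rightarrow> bool" where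
  "cayley_adj G S x y \<longleftrightarrow> x \<in> carrier G \<and> y \<in> carrier G \<and>
     (\<exists>s\<in>S. y = s \<otimes>\<^bsub>G\<^esub> x \<or> x = s \<otimes>\<^bsub>G\<^esub> y)"

definition cayley_perfect_code :: "('g, 'b) monoid_scheme \<Rightarrow> 'g set \<Rightarrow> 'g set \<Rightarrow> bool" where
  "cayley_perfect_code G S C \<longleftrightarrow> C \<subseteq> carrier G \<and>
     (\<forall>c1\<in>C. \<forall>c2\<in>C. \<not> cayley_adj G S c1 c2) \<and>
     (\<forall>g\<in>carrier G - C. \<exists>!c. c \<in> C \<and> cayley_adj G S g c)"

definition is_perfect_code_of :: "('g, 'b) monoid_scheme \<Rightarrow> 'g set \<Rightarrow> bool" where
  "is_perfect_code_of G H \<longleftrightarrow> (\<exists>S. S \<subseteq> carrier G - {\<one>\<^bsub>G\<^esub>} \<and>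
     (\<forall>s\<in>S. inv\<^bsub>G\<^esub> s \<in> S) \<and> cayley_perfect_code G S H)"

definition AGL2 :: "(('a::field \<times> 'a) \<Rightarrow> ('a \<times> 'a)) set" where
  "AGL2 = {f. \<exists>a b c d e1 e2. a * d - b * c \<noteq> 0 \<and>
              f = (\<lambda>(x, y). (a * x + b * y + e1, c * x + d * y + e2))}"

end

theory Submission
  imports Defs "HOL-Algebra.Group_Action" "HOL-Algebra.Sylow" "HOL-Algebra.Multiplicative_Group" "HOL-Number_Theory.Cong"
begin

text \<open>
  A subgroup \<open>H\<close> is a perfect code iff its left cosets have an inverse-closed transversal. Any left
  coset in \<open>HgH\<close> can be paired with any left coset in \<open>Hg\<inverse>H\<close> by an element and its inverse, so
  the only obstruction is a self-inverse double coset with an odd number of left cosets and without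
  an element of square \<open>1\<close>. If \<open>Q\<close> is a Sylow 2-subgroup of \<open>H\<close>, parity yields in such a double
  coset some \<open>y\<close> that normalises \<open>Q\<close> and has \<open>y\<^sup>2 \<in> Q\<close>; it remains to find an
  element of square \<open>1\<close> in \<open>yQ\<close>.

  As \<open>-1\<close> is not a square, \<open>F\<^sub>q \<times> F\<^sub>q\<close> is the field \<open>F\<^sub>q(i)\<close>, and \<open>Q\<close> consists of the maps
  \<open>v \<mapsto> uv\<close> and \<open>v \<mapsto> u cnj(v)\<close> with \<open>u\<close> of 2-power order. By Hilbert 90 the reflections in \<open>Q\<close>
  are conjugate in \<open>Q\<close>, so \<open>y\<close> may be multiplied by an element of \<open>Q\<close> to commute with conjugation
  \<open>\<tau>\<close>. Then \<open>y\<^sup>2\<close> is \<open>\<plusminus>1\<close> or \<open>\<plusminus>\<tau>\<close>, and it is \<open>1\<close>: otherwise \<open>y\<^sup>2\<close> acts as \<open>-1\<close> on the \<open>q - 1\<close>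
  nonzero elements of \<open>F\<^sub>q\<close> or of \<open>iF\<^sub>q\<close>, although \<open>4\<close> does not divide \<open>q - 1\<close>.
\<close>

section \<open>Parity arguments\<close>

text \<open>The sets \<open>{x, f x}\<close> have two elements each and partition
  \<open>A\<close>.\<close>

lemma even_card_if_involution_no_fixpoint:
  assumes "finite A" "\<And>x. x \<in> A \<Longrightarrow> f x \<in> A" "\<And>x. x \<in> A \<Longrightarrow> f (f x) = x"
    "\<And>x. x \<in> A \<Longrightarrow> f x \<noteq> x"
  shows "even (card A)"
proof -
  have "2 dvd card (\<Union>((\<lambda>x. {x, f x}) ` A))"
  proof (rule dvd_partition)
    show "finite (\<Union>((\<lambda>x. {x, f x}) ` A))"
      using assms(1) by auto
    show "\<forall>c\<in>(\<lambda>x. {x, f x}) ` A. 2 dvd card c"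
      using assms(4) by (force simp: card_insert_if)
    show "\<forall>c1\<in>(\<lambda>x. {x, f x}) ` A. \<forall>c2\<in>(\<lambda>x. {x, f x}) ` A. c1 \<noteq> c2 \<longrightarrow> c1 \<inter> c2 = {}"
    proof -
      have "{y, f y} = {x, f x}" if "x \<in> A" "y \<in> {x, f x}" for x y
        using that assms(3)[of x] by auto
      then have "{x, f x} = {y, f y}" if "x \<in> A" "y \<in> A" "z \<in> {x, f x}" "z \<in> {y, f y}" for x y z
        using that by metis
      then show ?thesis by blast
    qed
  qed
  moreover have "\<Union>((\<lambda>x. {x, f x}) ` A) = A"
    using assms(2) by auto
  ultimately show ?thesis by simp
qed

text \<open>Orbits of length 1 or 2 would contain fixed points of the square of \<open>f\<close>, so
  every orbit has exactly four elements.\<close>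

lemma four_dvd_card_if_square_no_fixpoint:
  assumes "finite A" "\<And>x. x \<in> A \<Longrightarrow> f x \<in> A" "\<And>x. x \<in> A \<Longrightarrow> f (f (f (f x))) = x"
    "\<And>x. x \<in> A \<Longrightarrow> f (f x) \<noteq> x"
  shows "4 dvd card A"
proof -
  define B where "B = (\<lambda>x. {x, f x, f (f x), f (f (f x))})"
  have "4 dvd card (\<Union>(B ` A))"
  proof (rule dvd_partition)
    show "finite (\<Union>(B ` A))"
      using assms(1) by (auto simp: B_def)
    have "card (B x) = 4" if x: "x \<in> A" for x
    proof -
      have "x \<noteq> f (f x)" "f x \<noteq> f (f (f x))"
        using assms(2)[OF x] assms(4)[OF x] assms(4)[of "f x"] by auto
      moreover from this have "x \<noteq> f x" "x \<noteq> f (f (f x))" "f x \<noteq> f (f x)" "f (f x) \<noteq> f (f (f x))"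
        using assms(3)[OF x] by metis+
      ultimately show ?thesis
        by (simp add: B_def card_insert_if)
    qed
    then show "\<forall>c\<in>B ` A. 4 dvd card c"
      by auto
    have same: "B y = B x" if "x \<in> A" "y \<in> B x" for x y
      using that assms(3)[of x] by (auto simp: B_def)
    have "B x = B y" if "x \<in> A" "y \<in> A" "z \<in> B x" "z \<in> B y" for x y z
      using same that by metis
    then show "\<forall>c1\<in>B ` A. \<forall>c2\<in>B ` A. c1 \<noteq> c2 \<longrightarrow> c1 \<inter> c2 = {}"
      by blast
  qed
  moreover have "\<Union>(B ` A) = A"
    using assms(2) by (auto simp: B_def)
  ultimately show ?thesis by simp
qed

text \<open>The size of an orbit divides \<open>p ^ n\<close>. An orbit with more than one point
  therefore has size divisible by \<open>p\<close>, and only the fixed points count modulo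
  \<open>p\<close>.\<close>

lemma (in group_action) prime_power_group_fixpoints_cong:
  fixes p n :: nat
  assumes p: "prime p" "order G = p ^ n" and E: "finite E"
  shows "[card E = card {x \<in> E. \<forall>g\<in>carrier G. \<phi> g x = x}] (mod p)"
proof -
  interpret G: group G
    using group_hom group_hom.axioms(1) by blast
  define F where "F = {x \<in> E. \<forall>g\<in>carrier G. \<phi> g x = x}"
  have orbsub: "orbit G \<phi> x \<subseteq> E - F" if x: "x \<in> E - F" for x
  proof
    fix y assume y: "y \<in> orbit G \<phi> x"
    then have yE: "y \<in> E"
      using x element_image by (auto simp: orbit_def)
    have "x \<in> orbit G \<phi> y"
      using orbit_sym x y yE by blast
    then have "y \<noteq> x \<Longrightarrow> y \<notin> F"
      by (force simp: orbit_def F_def)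
    then show "y \<in> E - F"
      using yE x by blast
  qed
  have "p dvd card (\<Union>(orbit G \<phi> ` (E - F)))"
  proof (rule dvd_partition)
    show "finite (\<Union>(orbit G \<phi> ` (E - F)))"
      using orbsub E by (meson UN_least finite_Diff finite_subset)
    have "p dvd card (orbit G \<phi> x)" if x: "x \<in> E - F" for x
    proof -
      have "card (orbit G \<phi> x) dvd p ^ n"
        using orbit_stabilizer_theorem[of x] x p by (metis DiffD1 dvd_triv_left)
      then obtain i where i: "card (orbit G \<phi> x) = p ^ i"
        using p(1) divides_primepow_nat by blast
      obtain g where g: "g \<in> carrier G" "\<phi> g x \<noteq> x"
        using x by (auto simp: F_def)
      have "{x, \<phi> g x} \<subseteq> orbit G \<phi> x"
        using g orbit_refl x by (auto simp: orbit_def)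
      moreover have "finite (orbit G \<phi> x)"
        using orbsub x E by (meson finite_Diff finite_subset)
      ultimately have "card {x, \<phi> g x} \<le> card (orbit G \<phi> x)"
        by (rule card_mono[rotated])
      then have "i \<noteq> 0"
        using i g by (intro notI) simp
      then show ?thesis
        using i by simp
    qed
    then show "\<forall>c\<in>orbit G \<phi> ` (E - F). p dvd card c"
      by blast
    show "\<forall>c1\<in>orbit G \<phi> ` (E - F). \<forall>c2\<in>orbit G \<phi> ` (E - F). c1 \<noteq> c2 \<longrightarrow> c1 \<inter> c2 = {}"
    proof (intro ballI impI)
      fix c1 c2 assume "c1 \<in> orbit G \<phi> ` (E - F)" "c2 \<in> orbit G \<phi> ` (E - F)" "c1 \<noteq> c2"
      moreover from this have "c1 \<in> orbits G E \<phi>" "c2 \<in> orbits G E \<phi>"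
        by (auto simp: orbits_def)
      ultimately show "c1 \<inter> c2 = {}"
        using disjoint_union by blast
    qed
  qed
  moreover have "\<Union>(orbit G \<phi> ` (E - F)) = E - F"
    using orbsub orbit_refl by blast
  moreover have "card E = card F + card (E - F)"
    using E by (subst card_Diff_subset) (auto simp: F_def card_mono)
  ultimately show ?thesis
    unfolding F_def[symmetric] by (simp add: cong_def mod_add_eq dvd_eq_mod_eq_0)
       (metis add.right_neutral mod_add_right_eq)
qed

section \<open>Subgroup perfect codes\<close>

no_notation subset_mset (infix "<#" 50)

definition double_coset :: "('g, 'b) monoid_scheme \<Rightarrow> 'g set \<Rightarrow> 'g \<Rightarrow> 'g set" where
  "double_coset G H x = {h \<otimes>\<^bsub>G\<^esub> x \<otimes>\<^bsub>G\<^esub> k | h k. h \<in> H \<and> k \<in> H}"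

context group
begin

section \<open>Left cosets and double cosets\<close>

lemma mem_l_coset_iff:
  assumes "subgroup H G" "x \<in> carrier G" "y \<in> carrier G"
  shows "y \<in> x <# H \<longleftrightarrow> inv x \<otimes> y \<in> H"
proof
  interpret H: subgroup H G by fact
  show "inv x \<otimes> y \<in> H" if y: "y \<in> x <# H"
  proof -
    obtain h where "h \<in> H" "y = x \<otimes> h"
      using y by (auto simp: l_coset_def)
    then show ?thesis
      using assms by (simp add: inv_solve_left' H.mem_carrier m_assoc[symmetric])
  qed
  show "y \<in> x <# H" if "inv x \<otimes> y \<in> H"
  proof -
    have "y = x \<otimes> (inv x \<otimes> y)"
      using assms by (simp add: m_assoc[symmetric])
    then show ?thesis
      using that by (auto simp: l_coset_def)
  qed
qed

lemma l_coset_eq_if_mem: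
  assumes "subgroup H G" "x \<in> carrier G" "y \<in> x <# H"
  shows "y <# H = x <# H"
  using l_repr_independence[OF assms(3,2,1)] by simp

lemma card_l_coset:
  assumes "H \<subseteq> carrier G" "x \<in> carrier G"
  shows "card (x <# H) = card H"
proof -
  have "x <# H = (\<lambda>h. x \<otimes> h) ` H"
    by (auto simp: l_coset_def)
  moreover have "inj_on (\<lambda>h. x \<otimes> h) H"
    using assms by (auto simp: inj_on_def subset_eq)
  ultimately show ?thesis
    by (simp add: card_image)
qed

lemma self_mem_l_coset:
  assumes "subgroup H G" "x \<in> carrier G"
  shows "x \<in> x <# H"
  using assms by (simp add: mem_l_coset_iff subgroup.one_closed)

text \<open>Lagrange's count inside a union of left cosets. It serves to count one double coset both
  by the left cosets of \<open>H\<close> and by those of a Sylow subgroup of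
  \<open>H\<close>.\<close>

lemma card_eq_card_l_cosets:
  assumes H: "subgroup H G" and D: "D \<subseteq> carrier G" "finite D"
    and closed: "\<And>x. x \<in> D \<Longrightarrow> x <# H \<subseteq> D"
  shows "card D = card H * card ((\<lambda>x. x <# H) ` D)"
proof -
  have U: "\<Union>((\<lambda>x. x <# H) ` D) = D"
    using closed self_mem_l_coset[OF H] D by blast
  have "card H * card ((\<lambda>x. x <# H) ` D) = card (\<Union>((\<lambda>x. x <# H) ` D))"
  proof (rule card_partition)
    show "finite (\<Union>((\<lambda>x. x <# H) ` D))"
      unfolding U by (fact D)
    fix c assume "c \<in> (\<lambda>x. x <# H) ` D"
    then show "card c = card H"
      using card_l_coset D subgroup.subset[OF H] by auto
  next
    fix c1 c2 assume "c1 \<in> (\<lambda>x. x <# H) ` D" "c2 \<in> (\<lambda>x. x <# H) ` D" "c1 \<noteq> c2"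
    then show "c1 \<inter> c2 = {}"
      using l_coset_eq_if_mem[OF H] D by (smt (verit) Int_emptyI imageE subset_eq)
  qed (use D in auto)
  then show ?thesis
    by (simp add: U)
qed

lemma self_mem_double_coset:
  assumes "subgroup H G" "x \<in> carrier G"
  shows "x \<in> double_coset G H x"
proof -
  have "x = \<one> \<otimes> x \<otimes> \<one>"
    using assms by simp
  then show ?thesis
    using subgroup.one_closed[OF assms(1)] by (auto simp: double_coset_def)
qed

lemma double_coset_subset_carrier:
  assumes "subgroup H G" "x \<in> carrier G"
  shows "double_coset G H x \<subseteq> carrier G"
  using assms subgroup.mem_carrier by (fastforce simp: double_coset_def)

lemma double_coset_mult_closed:
  assumes H: "subgroup H G" and x: "x \<in> carrier G" and y: "y \<in> double_coset G H x"
    and hk: "h \<in> H" "k \<in> H"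
  shows "h \<otimes> y \<otimes> k \<in> double_coset G H x"
proof -
  interpret H: subgroup H G by fact
  obtain h' k' where y': "h' \<in> H" "k' \<in> H" "y = h' \<otimes> x \<otimes> k'"
    using y by (auto simp: double_coset_def)
  then have "h \<otimes> y \<otimes> k = (h \<otimes> h') \<otimes> x \<otimes> (k' \<otimes> k)"
    using hk x by (simp add: m_assoc)
  then show ?thesis
    using hk y' unfolding double_coset_def by blast
qed

lemma l_coset_subset_double_coset:
  assumes H: "subgroup H G" and x: "x \<in> carrier G" and y: "y \<in> double_coset G H x"
  shows "y <# H \<subseteq> double_coset G H x"
proof
  fix z assume "z \<in> y <# H"
  then obtain k where k: "k \<in> H" "z = y \<otimes> k"
    by (auto simp: l_coset_def)
  moreover have "y \<in> carrier G"
    using double_coset_subset_carrier[OF H x] y by blast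
  ultimately show "z \<in> double_coset G H x"
    using double_coset_mult_closed[OF H x y subgroup.one_closed[OF H] k(1)] by simp
qed

lemma double_coset_eq_if_mem:
  assumes H: "subgroup H G" and x: "x \<in> carrier G" and y: "y \<in> double_coset G H x"
  shows "double_coset G H y = double_coset G H x"
proof -
  interpret H: subgroup H G by fact
  have yc: "y \<in> carrier G"
    using double_coset_subset_carrier[OF H x] y by blast
  obtain h k where hk: "h \<in> H" "k \<in> H" "y = h \<otimes> x \<otimes> k"
    using y by (auto simp: double_coset_def)
  have "inv h \<otimes> y \<otimes> inv k = (inv h \<otimes> h) \<otimes> x \<otimes> (k \<otimes> inv k)"
    using hk x by (simp only: m_assoc H.mem_carrier inv_closed m_closed)
  then have "x = inv h \<otimes> y \<otimes> inv k"
    using hk x by simp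
  then have xy: "x \<in> double_coset G H y"
    using hk unfolding double_coset_def by blast
  show ?thesis
  proof
    show "double_coset G H y \<subseteq> double_coset G H x"
      using double_coset_mult_closed[OF H x y] by (auto simp: double_coset_def[of G H y])
    show "double_coset G H x \<subseteq> double_coset G H y"
      using double_coset_mult_closed[OF H yc xy] by (auto simp: double_coset_def[of G H x])
  qed
qed

lemma inv_mem_double_coset:
  assumes H: "subgroup H G" and x: "x \<in> carrier G" and y: "y \<in> double_coset G H x"
  shows "inv y \<in> double_coset G H (inv x)"
proof -
  interpret H: subgroup H G by fact
  obtain h k where hk: "h \<in> H" "k \<in> H" "y = h \<otimes> x \<otimes> k"
    using y by (auto simp: double_coset_def)
  then have "inv y = inv k \<otimes> inv x \<otimes> inv h"
    using x by (simp add: inv_mult_group m_assoc)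
  then show ?thesis
    using hk unfolding double_coset_def by blast
qed

text \<open>Inversion turns left cosets into right cosets, so it does not match the two families
  directly. It does show that the two double cosets have equal size, and dividing by
  \<open>card H\<close> gives the claim.\<close>

lemma card_l_cosets_double_coset_inv:
  assumes H: "subgroup H G" and x: "x \<in> carrier G" and fin: "finite (carrier G)"
  shows "card ((\<lambda>x. x <# H) ` double_coset G H (inv x)) = card ((\<lambda>x. x <# H) ` double_coset G H x)"
proof -
  note sub = double_coset_subset_carrier[OF H]
  have "m_inv G ` double_coset G H x = double_coset G H (inv x)"
  proof
    show "m_inv G ` double_coset G H x \<subseteq> double_coset G H (inv x)"
      using inv_mem_double_coset[OF H x] by blast
    show "double_coset G H (inv x) \<subseteq> m_inv G ` double_coset G H x"
    proof
      fix y assume y: "y \<in> double_coset G H (inv x)"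
      then have "inv y \<in> double_coset G H x"
        using inv_mem_double_coset[OF H, of "inv x"] x by simp
      moreover have "y = inv (inv y)"
        using sub[of "inv x"] x y by auto
      ultimately show "y \<in> m_inv G ` double_coset G H x"
        by blast
    qed
  qed
  moreover have "inj_on (m_inv G) (double_coset G H x)"
  proof (rule inj_onI)
    fix a b assume "a \<in> double_coset G H x" "b \<in> double_coset G H x" "inv a = inv b"
    then show "a = b"
      using sub[OF x] inv_inv by (metis subsetD)
  qed
  ultimately have "card (double_coset G H (inv x)) = card (double_coset G H x)"
    using card_image by metis
  moreover have "card (double_coset G H y) = card H * card ((\<lambda>x. x <# H) ` double_coset G H y)"
    if "y \<in> carrier G" for y
    using that fin by (intro card_eq_card_l_cosets[OF H] sub l_coset_subset_double_coset[OF H])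
      (auto intro: finite_subset[OF sub])
  moreover have "card H > 0"
    using subgroup.finite_imp_card_positive[OF H fin] .
  ultimately show ?thesis
    using x by simp
qed

text \<open>Inside a double coset every left coset meets every right coset, so any left coset in
  \<open>HxH\<close> can be matched with any left coset in \<open>Hx\<inverse>H\<close>.\<close>

lemma l_cosets_matched_by_inverse:
  assumes H: "subgroup H G" and x: "x \<in> carrier G"
    and C: "C \<in> (\<lambda>x. x <# H) ` double_coset G H x"
    and C': "C' \<in> (\<lambda>x. x <# H) ` double_coset G H (inv x)"
  shows "\<exists>z\<in>C. inv z \<in> C'"
proof -
  interpret H: subgroup H G by fact
  obtain h k where hk: "h \<in> H" "k \<in> H" "C = (h \<otimes> x \<otimes> k) <# H"
    using C by (auto simp: double_coset_def)
  obtain h' k' where hk': "h' \<in> H" "k' \<in> H" "C' = (h' \<otimes> inv x \<otimes> k') <# H"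
    using C' by (auto simp: double_coset_def)
  have shift: "a \<otimes> b \<in> (a \<otimes> c) <# H" if "a \<in> carrier G" "b \<in> H" "c \<in> H" for a b c
  proof -
    have "a \<otimes> b = (a \<otimes> c) \<otimes> (inv c \<otimes> b)"
      using that by (simp add: m_assoc) (simp add: m_assoc[symmetric])
    then show ?thesis
      using that by (auto simp: l_coset_def)
  qed
  have "(h \<otimes> x) \<otimes> inv h' \<in> C"
    using hk hk' x by (simp add: shift)
  moreover have "inv ((h \<otimes> x) \<otimes> inv h') = (h' \<otimes> inv x) \<otimes> inv h"
    using hk hk' x by (simp add: inv_mult_group m_assoc)
  moreover have "(h' \<otimes> inv x) \<otimes> inv h \<in> C'"
    using hk hk' x by (simp add: shift)
  ultimately show ?thesis by metis
qed

text \<open>Fix a bijection \<open>f\<close> from \<open>A\<close> to \<open>B\<close>. Each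
  \<open>C\<close> in \<open>A\<close> contains some \<open>z\<close> whose inverse lies in
  \<open>f C\<close>; \<open>z\<close> represents \<open>C\<close> and its inverse represents
  \<open>f C\<close>. As \<open>A\<close> and \<open>B\<close> are disjoint, no coset is represented
  twice.\<close>

lemma matched_representatives_exist:
  assumes H: "subgroup H G" and x: "x \<in> carrier G"
    and A: "A \<subseteq> (\<lambda>x. x <# H) ` double_coset G H x" "finite A"
    and B: "B \<subseteq> (\<lambda>x. x <# H) ` double_coset G H (inv x)" "finite B"
    and AB: "A \<inter> B = {}" "card A = card B"
  shows "\<exists>r. \<forall>C\<in>A \<union> B. r C \<in> C \<and> (\<exists>C'\<in>A \<union> B. inv (r C) = r C')"
proof -
  obtain f where f: "bij_betw f A B"
    using finite_same_card_bij[OF A(2) B(2) AB(2)] by blast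
  have "\<forall>C\<in>A. \<exists>z. z \<in> C \<and> inv z \<in> f C"
  proof
    fix C assume "C \<in> A"
    then have "f C \<in> B"
      using f by (auto simp: bij_betw_def)
    then show "\<exists>z. z \<in> C \<and> inv z \<in> f C"
      using l_cosets_matched_by_inverse[OF H x subsetD[OF A(1) \<open>C \<in> A\<close>] subsetD[OF B(1)]]
      by (simp add: Bex_def)
  qed
  then obtain z where z: "\<And>C. C \<in> A \<Longrightarrow> z C \<in> C" "\<And>C. C \<in> A \<Longrightarrow> inv (z C) \<in> f C"
    by metis
  define r where "r C = (if C \<in> A then z C else inv (z (inv_into A f C)))" for C
  have zc: "z C \<in> carrier G" if CA: "C \<in> A" for C
  proof -
    obtain y where "y \<in> double_coset G H x" "C = y <# H"
      using subsetD[OF A(1) CA] by blast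
    then show ?thesis
      using z(1)[OF CA] l_coset_subset_double_coset[OF H x] double_coset_subset_carrier[OF H x]
      by blast
  qed
  have rf: "r (f C) = inv (z C)" "f C \<in> B" if "C \<in> A" for C
    using that f AB(1) by (auto simp: r_def bij_betw_def disjoint_iff)
  have "r C \<in> C \<and> (\<exists>C'\<in>A \<union> B. inv (r C) = r C')" if C: "C \<in> A \<union> B" for C
  proof (cases "C \<in> A")
    case True
    then have "r C = z C"
      by (simp add: r_def)
    then show ?thesis
      using z(1)[OF True] rf[OF True] by (metis UnI2)
  next
    case False
    then obtain C0 where C0: "C0 \<in> A" "C = f C0"
      using C f by (auto simp: bij_betw_def)
    have "inv (r C) = r C0"
      using rf[OF C0(1)] zc[OF C0(1)] C0 by (simp add: r_def)
    then show ?thesis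
      using C0 z(2)[OF C0(1)] rf(1)[OF C0(1)] by auto
  qed
  then show ?thesis by blast
qed

text \<open>Distinct double cosets of \<open>x\<close> and its inverse are matched with each other.
  A self-inverse double coset with an even number of left cosets is split into halves that are
  matched; if the number is odd, an element of square 1 first represents its own coset.\<close>

lemma representatives_of_double_coset_pair:
  assumes H: "subgroup H G" and x: "x \<in> carrier G" and fin: "finite (carrier G)"
    and inv_or_even: "\<And>y. \<lbrakk>y \<in> carrier G; inv y \<in> double_coset G H y;
        odd (card ((\<lambda>x. x <# H) ` double_coset G H y))\<rbrakk>
      \<Longrightarrow> \<exists>z\<in>double_coset G H y. z \<otimes> z = \<one>"
  defines "X \<equiv> (\<lambda>x. x <# H) ` (double_coset G H x \<union> double_coset G H (inv x))"
  shows "\<exists>r. \<forall>C\<in>X. r C \<in> C \<and> (\<exists>C'\<in>X. inv (r C) = r C')"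
proof -
  let ?L = "\<lambda>x. (\<lambda>x. x <# H) ` double_coset G H x"
  have fin': "finite (?L y)" if "y \<in> carrier G" for y
    using finite_subset[OF double_coset_subset_carrier[OF H that] fin] by blast
  have X: "X = ?L x \<union> ?L (inv x)"
    by (auto simp: X_def)
  show ?thesis
  proof (cases "inv x \<in> double_coset G H x")
    case False
    have "?L x \<inter> ?L (inv x) = {}"
    proof (rule ccontr)
      assume "?L x \<inter> ?L (inv x) \<noteq> {}"
      then obtain y z where yz: "y \<in> double_coset G H x" "z \<in> double_coset G H (inv x)" "y <# H = z <# H"
        by blast
      then have "z \<in> y <# H"
        using self_mem_l_coset[OF H, of z] double_coset_subset_carrier[OF H, of "inv x"] x by auto
      then have "z \<in> double_coset G H x"
        using yz l_coset_subset_double_coset[OF H x] by blast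
      then have "double_coset G H x = double_coset G H (inv x)"
        using double_coset_eq_if_mem[OF H x] double_coset_eq_if_mem[OF H _ yz(2)] x by simp
      then show False
        using False self_mem_double_coset[OF H, of "inv x"] x by simp
    qed
    then show ?thesis
      unfolding X using x fin'
      by (intro matched_representatives_exist[OF H x] card_l_cosets_double_coset_inv[symmetric] H fin)
        auto
  next
    case True
    then have eq: "double_coset G H (inv x) = double_coset G H x"
      by (rule double_coset_eq_if_mem[OF H x])
    have X': "X = ?L x"
      using X eq by simp
    \<comment> \<open>Here both double cosets coincide, so any two halves of an even family
      \<open>Y\<close> can be matched.\<close>
    have pairing: "\<exists>r. \<forall>C\<in>Y. r C \<in> C \<and> (\<exists>C'\<in>Y. inv (r C) = r C')" if "Y \<subseteq> X" "even (card Y)" for Y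
    proof -
      have finY: "finite Y"
        using that X' fin' x finite_subset by metis
      obtain A where A: "A \<subseteq> Y" "card A = card Y div 2"
        using obtain_subset_with_card_n[of "card Y div 2" Y] by auto
      have "card (Y - A) = card Y - card A"
        using A finY by (simp add: card_Diff_subset finite_subset)
      then have "card A = card (Y - A)"
        using A that(2) by auto
      then have "\<exists>r. \<forall>C\<in>A \<union> (Y - A). r C \<in> C \<and> (\<exists>C'\<in>A \<union> (Y - A). inv (r C) = r C')"
        using A that(1) X' finY eq
        by (intro matched_representatives_exist[OF H x]) (auto intro: finite_subset)
      then show ?thesis
        using A by (simp add: Un_absorb1)
    qed
    show ?thesis
    proof (cases "even (card X)")
      case True
      then show ?thesis
        using pairing by blast
    next
      case False
      then obtain z where z: "z \<in> double_coset G H x" "z \<otimes> z = \<one>"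
        using inv_or_even[OF x True] X' by auto
      have zc: "z \<in> carrier G"
        using z double_coset_subset_carrier[OF H x] by blast
      have zinv: "inv z = z"
        using inv_equality[OF z(2) zc zc] .
      have zX: "z <# H \<in> X"
        using z X' by blast
      have "even (card (X - {z <# H}))"
        using False zX by (cases "card X") (auto simp: card_Diff_singleton)
      then obtain r where r: "\<forall>C\<in>X - {z <# H}. r C \<in> C \<and> (\<exists>C'\<in>X - {z <# H}. inv (r C) = r C')"
        using pairing[of "X - {z <# H}"] by auto
      let ?r = "r(z <# H := z)"
      have "?r C \<in> C \<and> (\<exists>C'\<in>X. inv (?r C) = ?r C')" if "C \<in> X" for C
      proof (cases "C = z <# H")
        case True
        then show ?thesis
          using zX zinv self_mem_l_coset[OF H zc] by auto
      next
        case False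
        then have "C \<in> X - {z <# H}"
          using that by simp
        then obtain C' where "r C \<in> C" "C' \<in> X" "C' \<noteq> z <# H" "inv (r C) = r C'"
          using bspec[OF r] by auto
        then show ?thesis
          using False by (intro conjI bexI[of _ C']) auto
      qed
      then show ?thesis by blast
    qed
  qed
qed

text \<open>An element \<open>c\<close> of \<open>H\<close> is adjacent to \<open>g\<close> iff
  \<open>g\<close> times the inverse of \<open>c\<close> lies in \<open>S\<close>. So the neighbours
  of \<open>g\<close> in \<open>H\<close> correspond to the elements of \<open>S\<close> in the
  coset \<open>g <# H\<close>.\<close>

lemma perfect_code_if_inverse_closed_transversal:
  assumes H: "subgroup H G" and S: "S \<subseteq> carrier G - H" "\<And>s. s \<in> S \<Longrightarrow> inv s \<in> S"
    and tr: "\<And>g. g \<in> carrier G - H \<Longrightarrow> \<exists>!s. s \<in> S \<and> s \<in> g <# H"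
  shows "is_perfect_code_of G H"
proof -
  interpret H: subgroup H G by fact
  have adj: "cayley_adj G S g c \<longleftrightarrow> g \<otimes> inv c \<in> S" if gc: "g \<in> carrier G" "c \<in> carrier G" for g c
  proof
    assume "cayley_adj G S g c"
    then obtain s where s: "s \<in> S" "c = s \<otimes> g \<or> g = s \<otimes> c"
      by (auto simp: cayley_adj_def)
    have sc: "s \<in> carrier G"
      using s S by blast
    from s(2) show "g \<otimes> inv c \<in> S"
    proof
      assume "c = s \<otimes> g"
      then have "g \<otimes> inv c = inv s"
        using gc sc by (simp add: inv_mult_group m_assoc[symmetric])
      then show ?thesis
        using S s by simp
    next
      assume "g = s \<otimes> c"
      then show ?thesis
        using gc sc s by (simp add: m_assoc)
    qed
  next
    assume "g \<otimes> inv c \<in> S"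
    moreover have "g = (g \<otimes> inv c) \<otimes> c"
      using gc by (simp add: m_assoc)
    ultimately show "cayley_adj G S g c"
      using gc unfolding cayley_adj_def by metis
  qed
  have "\<not> cayley_adj G S c d" if "c \<in> H" "d \<in> H" for c d
    using that adj[of c d] S(1) by auto
  moreover have "\<exists>!c. c \<in> H \<and> cayley_adj G S g c" if g: "g \<in> carrier G - H" for g
  proof -
    obtain s where s: "s \<in> S" "s \<in> g <# H" and uniq: "\<And>t. t \<in> S \<Longrightarrow> t \<in> g <# H \<Longrightarrow> t = s"
      using tr[OF g] by blast
    obtain h where h: "h \<in> H" "s = g \<otimes> h"
      using s(2) by (auto simp: l_coset_def)
    show ?thesis
    proof
      show "inv h \<in> H \<and> cayley_adj G S g (inv h)"
        using h g s adj by auto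
      fix c assume c: "c \<in> H \<and> cayley_adj G S g c"
      then have "g \<otimes> inv c \<in> S" "g \<otimes> inv c \<in> g <# H"
        using adj g by (auto simp: l_coset_def)
      then have "g \<otimes> inv c = g \<otimes> h"
        using uniq h by blast
      then have "inv c = h"
        using g c h by auto
      then show "c = inv h"
        using c by auto
    qed
  qed
  ultimately have "cayley_perfect_code G S H"
    using H.subset by (auto simp: cayley_perfect_code_def)
  moreover have "S \<subseteq> carrier G - {\<one>}"
    using S by auto
  ultimately show ?thesis
    unfolding is_perfect_code_of_def using S(2) by blast
qed

text \<open>The sets \<open>E x\<close> are closed under inversion and partition the group, and each
  is a union of left cosets. The connection set is the union of one inverse-closed transversal for
  each \<open>E x\<close> outside \<open>H\<close>.\<close>

lemma perfect_code_if_odd_double_cosets_contain_involution: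
  assumes H: "subgroup H G" and fin: "finite (carrier G)"
    and inv_or_even: "\<And>y. \<lbrakk>y \<in> carrier G; inv y \<in> double_coset G H y;
        odd (card ((\<lambda>x. x <# H) ` double_coset G H y))\<rbrakk>
      \<Longrightarrow> \<exists>z\<in>double_coset G H y. z \<otimes> z = \<one>"
  shows "is_perfect_code_of G H"
proof -
  interpret H: subgroup H G by fact
  note dsub = double_coset_subset_carrier[OF H] and deq = double_coset_eq_if_mem[OF H]
  define E where "E x = double_coset G H x \<union> double_coset G H (inv x)" for x
  have Ecar: "E x \<subseteq> carrier G" if "x \<in> carrier G" for x
    using dsub that by (auto simp: E_def)
  have Eeq: "E y = E x" if x: "x \<in> carrier G" and y: "y \<in> E x" for x y
  proof -
    have yc: "y \<in> carrier G"
      using Ecar x y by blast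
    show ?thesis
    proof (cases "y \<in> double_coset G H x")
      case True
      then show ?thesis
        using deq[OF x True] deq[OF _ inv_mem_double_coset[OF H x True]] x by (simp add: E_def)
    next
      case False
      then have *: "y \<in> double_coset G H (inv x)"
        using y by (simp add: E_def)
      then show ?thesis
        using deq[OF _ *] deq[OF _ inv_mem_double_coset[OF H _ *]] x by (simp add: E_def Un_commute)
    qed
  qed
  have Eself: "x \<in> E x" if "x \<in> carrier G" for x
    using self_mem_double_coset[OF H that] by (simp add: E_def)
  have Elc: "y <# H \<subseteq> E x" if "x \<in> carrier G" "y \<in> E x" for x y
    using l_coset_subset_double_coset[OF H, of x] l_coset_subset_double_coset[OF H, of "inv x"] that
    unfolding E_def by blast
  have EH: "E x \<inter> H = {}" if x: "x \<in> carrier G - H" for x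
  proof (rule ccontr)
    assume "E x \<inter> H \<noteq> {}"
    then obtain y where y: "y \<in> E x" "y \<in> H" by blast
    then have "x \<in> E y"
      using Eeq[of x y] Eself x by auto
    moreover have "E y \<subseteq> H"
      using y by (auto simp: E_def double_coset_def)
    ultimately show False
      using x by blast
  qed
  define good where "good T A \<longleftrightarrow> T \<subseteq> A \<and> (\<forall>s\<in>T. inv s \<in> T) \<and> (\<forall>c\<in>A. \<exists>!s. s \<in> T \<and> s \<in> c <# H)" for T A
  have "\<exists>T. good T (E x)" if x: "x \<in> carrier G" for x
  proof -
    let ?X = "(\<lambda>x. x <# H) ` E x"
    obtain r where r: "\<And>C. C \<in> ?X \<Longrightarrow> r C \<in> C" "\<And>C. C \<in> ?X \<Longrightarrow> \<exists>C'\<in>?X. inv (r C) = r C'"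
      using representatives_of_double_coset_pair[OF H x fin inv_or_even] unfolding E_def by blast
    have "good (r ` ?X) (E x)"
      unfolding good_def
    proof (intro conjI ballI)
      show "r ` ?X \<subseteq> E x"
        using r(1) Elc[OF x] by blast
      show "inv s \<in> r ` ?X" if "s \<in> r ` ?X" for s
        using that r(2) by blast
      fix c assume c: "c \<in> E x"
      show "\<exists>!s. s \<in> r ` ?X \<and> s \<in> c <# H"
      proof
        show "r (c <# H) \<in> r ` ?X \<and> r (c <# H) \<in> c <# H"
          using c r(1) by blast
        fix s assume s: "s \<in> r ` ?X \<and> s \<in> c <# H"
        then obtain d where d: "d \<in> E x" "s = r (d <# H)" by blast
        then have "s \<in> d <# H"
          using r(1) by blast
        then have "d <# H = c <# H"
          using l_coset_eq_if_mem[OF H] s c d Ecar[OF x] by blast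
        then show "s = r (c <# H)"
          using d by simp
      qed
    qed
    then show ?thesis by blast
  qed
  then have T: "good (SOME T. good T (E x)) (E x)" if "x \<in> carrier G" for x
    using that by (auto intro: someI_ex)
  \<comment> \<open>The choice depends on the set \<open>A\<close> alone, so all elements
    \<open>x\<close> of one class \<open>E x\<close> get the same transversal. This is what makes
    the representative in each left coset unique.\<close>
  define T where "T A = (SOME T. good T A)" for A
  note T = T[folded T_def]
  let ?S = "\<Union>x\<in>carrier G - H. T (E x)"
  show ?thesis
  proof (rule perfect_code_if_inverse_closed_transversal[OF H])
    have "T (E x) \<subseteq> E x" if "x \<in> carrier G" for x
      using T[OF that] by (simp add: good_def)
    then show "?S \<subseteq> carrier G - H"
      using Ecar EH by blast
    show "inv s \<in> ?S" if "s \<in> ?S" for s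
      using that T by (auto simp: good_def)
    fix g assume g: "g \<in> carrier G - H"
    then have gg: "\<exists>!s. s \<in> T (E g) \<and> s \<in> g <# H"
      using T[of g] Eself[of g] by (auto simp: good_def)
    have "s \<in> T (E g)" if s: "s \<in> ?S" "s \<in> g <# H" for s
    proof -
      obtain x where x: "x \<in> carrier G - H" "s \<in> T (E x)"
        using s by blast
      then have "s \<in> E x" "s \<in> E g"
        using T[of x] s(2) Elc[OF _ Eself, of g] g by (auto simp: good_def)
      then have "E x = E g"
        using Eeq[of x s] Eeq[of g s] x g by auto
      then show ?thesis
        using x by simp
    qed
    then show "\<exists>!s. s \<in> ?S \<and> s \<in> g <# H"
      using gg g by blast
  qed
qed

section \<open>The action of a Sylow 2-subgroup on the left cosets in a double coset\<close>

lemma left_multiplication_action_on_l_cosets: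
  assumes Q: "subgroup Q G" and D: "D \<subseteq> carrier G"
    and closed: "\<And>q d. \<lbrakk>q \<in> Q; d \<in> D\<rbrakk> \<Longrightarrow> q \<otimes> d \<in> D"
  defines "X \<equiv> (\<lambda>x. x <# Q) ` D"
  shows "group_action (G\<lparr>carrier := Q\<rparr>) X (\<lambda>q. \<lambda>C\<in>X. q <# C)"
proof -
  interpret Q: subgroup Q G by fact
  have mult: "q <# (d <# Q) = (q \<otimes> d) <# Q" if "q \<in> Q" "d \<in> D" for q d
    using that D by (intro lcos_m_assoc) auto
  have inX: "q <# C \<in> X" if "q \<in> Q" "C \<in> X" for q C
    using that mult closed by (auto simp: X_def)
  have comp: "q <# (q' <# C) = (q \<otimes> q') <# C" if q: "q \<in> Q" "q' \<in> Q" and C: "C \<in> X" for q q' C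
  proof -
    have "C \<subseteq> carrier G"
      using C D l_coset_subset_G[OF Q.subset] by (auto simp: X_def)
    then show ?thesis
      using q by (intro lcos_m_assoc) auto
  qed
  have one: "\<one> <# C = C" if C: "C \<in> X" for C
  proof -
    have "C \<subseteq> carrier G"
      using C D l_coset_subset_G[OF Q.subset] by (auto simp: X_def)
    then show ?thesis
      by (rule lcos_mult_one)
  qed
  have bij: "(\<lambda>C\<in>X. q <# C) \<in> Bij X" if q: "q \<in> Q" for q
  proof -
    have "bij_betw (\<lambda>C\<in>X. q <# C) X X"
      by (rule bij_betw_byWitness[where f' = "\<lambda>C. inv q <# C"]) (use q inX comp one in auto)
    then show ?thesis
      by (simp add: Bij_def)
  qed
  have "(\<lambda>q. \<lambda>C\<in>X. q <# C) \<in> hom (G\<lparr>carrier := Q\<rparr>) (BijGroup X)"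
  proof (rule homI)
    show "(\<lambda>C\<in>X. q <# C) \<in> carrier (BijGroup X)" if "q \<in> carrier (G\<lparr>carrier := Q\<rparr>)" for q
      using that bij by (simp add: BijGroup_def)
    fix q q' assume "q \<in> carrier (G\<lparr>carrier := Q\<rparr>)" "q' \<in> carrier (G\<lparr>carrier := Q\<rparr>)"
    then have q: "q \<in> Q" "q' \<in> Q" by auto
    then have "(\<lambda>C\<in>X. (q \<otimes> q') <# C) = compose X (\<lambda>C\<in>X. q <# C) (\<lambda>C\<in>X. q' <# C)"
      using comp inX by (auto simp: compose_def restrict_def fun_eq_iff)
    then show "(\<lambda>C\<in>X. (q \<otimes>\<^bsub>G\<lparr>carrier := Q\<rparr>\<^esub> q') <# C)
        = (\<lambda>C\<in>X. q <# C) \<otimes>\<^bsub>BijGroup X\<^esub> (\<lambda>C\<in>X. q' <# C)"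
      using q bij by (simp add: BijGroup_def)
  qed
  then show ?thesis
    using Q.subgroup_is_group[OF is_group] group_BijGroup
    by (simp add: group_action_def group_hom_def group_hom_axioms_def)
qed

text \<open>Both cosets have \<open>card Q\<close> elements, so one inclusion suffices.\<close>

lemma r_coset_eq_l_coset_if_subset:
  assumes Q: "subgroup Q G" and fin: "finite (carrier G)" and d: "d \<in> carrier G"
    and sub: "Q #> d \<subseteq> d <# Q"
  shows "d <# Q = Q #> d"
proof -
  have "card (Q #> d) = card Q"
    using card_rcosets_equal[OF rcosetsI] subgroup.subset[OF Q] d by simp
  moreover have "card (d <# Q) = card Q"
    using card_l_coset subgroup.subset[OF Q] d by blast
  moreover have "finite (d <# Q)"
    using finite_subset[OF l_coset_subset_G[OF subgroup.subset[OF Q] d] fin] .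
  ultimately show ?thesis
    using card_subset_eq[OF _ sub] by simp
qed

text \<open>The fixed points of \<open>Q\<close> on the left cosets \<open>dQ\<close> in \<open>HxH\<close> are those with \<open>d\<close> normalising
  \<open>Q\<close>. Their number is odd and \<open>dQ \<mapsto> d\<inverse>Q\<close> is an involution on them.\<close>

lemma odd_double_coset_meets_normaliser:
  assumes H: "subgroup H G" and fin: "finite (carrier G)"
    and Q: "subgroup Q G" "Q \<subseteq> H" "card Q = 2 ^ n" and odd_index: "card H = card Q * m" "odd m"
    and x: "x \<in> carrier G" "inv x \<in> double_coset G H x"
    and oddD: "odd (card ((\<lambda>x. x <# H) ` double_coset G H x))"
  shows "\<exists>d\<in>double_coset G H x. d <# Q = Q #> d \<and> d \<otimes> d \<in> Q"
proof -
  interpret H: subgroup H G by fact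
  interpret Q: subgroup Q G by fact
  define D where "D = double_coset G H x"
  define X where "X = (\<lambda>x. x <# Q) ` D"
  define A where "A = (\<lambda>q. \<lambda>C\<in>X. q <# C)"
  have Dc: "D \<subseteq> carrier G"
    unfolding D_def by (rule double_coset_subset_carrier[OF H x(1)])
  have finD: "finite D"
    using finite_subset[OF Dc fin] .
  have Dinv: "inv d \<in> D" if "d \<in> D" for d
    using inv_mem_double_coset[OF H x(1), of d] double_coset_eq_if_mem[OF H x] that by (simp add: D_def)
  have Dl: "q \<otimes> d \<in> D" if "q \<in> H" "d \<in> D" for q d
    using double_coset_mult_closed[OF H x(1), of d q \<one>] that Dc by (auto simp: D_def)
  have Dr: "d <# H \<subseteq> D" if "d \<in> D" for d
    using l_coset_subset_double_coset[OF H x(1)] that by (simp add: D_def)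
  have DrQ: "d <# Q \<subseteq> D" if "d \<in> D" for d
    using Dr[OF that] Q(2) by (auto simp: l_coset_def)
  \<comment> \<open>Counting \<open>D\<close> by left cosets of \<open>H\<close> and of
    \<open>Q\<close> gives \<open>m\<close> times as many of the latter, hence an odd number of
    both.\<close>
  have "card D = card H * card ((\<lambda>x. x <# H) ` D)"
    using card_eq_card_l_cosets[OF H Dc finD Dr] .
  moreover have "card D = card Q * card X"
    unfolding X_def using card_eq_card_l_cosets[OF Q(1) Dc finD DrQ] .
  ultimately have "card X = m * card ((\<lambda>x. x <# H) ` D)"
    using odd_index Q(3) by simp
  then have oddX: "odd (card X)"
    using odd_index oddD by (simp add: D_def)
  interpret A: group_action "G\<lparr>carrier := Q\<rparr>" X A
    unfolding X_def A_def using Dl Q(2) by (intro left_multiplication_action_on_l_cosets Q Dc) auto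
  define F where "F = {C \<in> X. \<forall>q\<in>Q. q <# C = C}"
  have "[card X = card {C \<in> X. \<forall>q\<in>carrier (G\<lparr>carrier := Q\<rparr>). A q C = C}] (mod 2)"
    using finD Q(3)
    by (intro A.prime_power_group_fixpoints_cong[where n = n]) (auto simp: X_def order_def)
  also have "{C \<in> X. \<forall>q\<in>carrier (G\<lparr>carrier := Q\<rparr>). A q C = C} = F"
    by (auto simp: F_def A_def)
  finally have oddF: "odd (card F)"
    using oddX by (auto simp: cong_def odd_iff_mod_2_eq_one)
  have mult: "q <# (d <# Q) = (q \<otimes> d) <# Q" if "q \<in> Q" "d \<in> D" for q d
    using that Dc by (intro lcos_m_assoc) auto
  \<comment> \<open>A coset fixed by \<open>Q\<close> contains every product
    \<open>q \<otimes> d\<close>, that is, all of \<open>Q #> d\<close>.\<close>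
  have norm: "d <# Q = Q #> d" if "d \<in> D" "d <# Q \<in> F" for d
  proof (rule r_coset_eq_l_coset_if_subset[OF Q(1) fin])
    show "Q #> d \<subseteq> d <# Q"
    proof
      fix y assume "y \<in> Q #> d"
      then obtain q where q: "q \<in> Q" "y = q \<otimes> d"
        by (auto simp: r_coset_def)
      then have "y <# Q = d <# Q"
        using that mult by (simp add: F_def)
      then show "y \<in> d <# Q"
        using self_mem_l_coset[OF Q(1), of y] q that Dc by auto
    qed
  qed (use that Dc in auto)
  \<comment> \<open>The inverse of a left coset is a right coset in general; here
    \<open>d <# Q\<close> is also a right coset, so its inverse is again a left one.\<close>
  have image: "m_inv G ` (d <# Q) = inv d <# Q" if d: "d \<in> D" "d <# Q \<in> F" for d
  proof -
    have dc: "d \<in> carrier G"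
      using d Dc by blast
    have "m_inv G ` (Q #> d) = (\<lambda>q. inv d \<otimes> q) ` m_inv G ` Q"
      using dc by (auto simp: r_coset_def inv_mult_group image_iff)
    moreover have "m_inv G ` Q = Q"
    proof
      show "Q \<subseteq> m_inv G ` Q"
        using Q.m_inv_closed by (metis Q.mem_carrier image_eqI inv_inv subsetI)
    qed auto
    ultimately show ?thesis
      using norm[OF d] by (auto simp: l_coset_def)
  qed
  have closed: "m_inv G ` C \<in> F" if C: "C \<in> F" for C
  proof -
    obtain d where d: "d \<in> D" "C = d <# Q"
      using C by (auto simp: F_def X_def)
    have dc: "d \<in> carrier G"
      using d Dc by blast
    have "q <# (inv d <# Q) = inv d <# Q" if q: "q \<in> Q" for q
    proof -
      have "d \<otimes> q \<in> Q #> d"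
        using norm[of d] d C q by (auto simp: l_coset_def)
      then obtain q' where q': "q' \<in> Q" "d \<otimes> q = q' \<otimes> d"
        by (auto simp: r_coset_def)
      have "inv (inv d) \<otimes> (q \<otimes> inv d) = d \<otimes> q \<otimes> inv d"
        using dc q by (simp add: m_assoc)
      also have "\<dots> = q'"
        using q' dc by (simp add: m_assoc)
      finally have "q \<otimes> inv d \<in> inv d <# Q"
        using mem_l_coset_iff[OF Q(1), of "inv d" "q \<otimes> inv d"] q' dc q by simp
      then show ?thesis
        using mult[OF q Dinv[OF d(1)]] l_coset_eq_if_mem[OF Q(1)] dc by simp
    qed
    then show ?thesis
      using image[OF d(1)] d C Dinv by (auto simp: F_def X_def)
  qed
  have "m_inv G ` m_inv G ` C = C" if "C \<in> F" for C
  proof -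
    have "C \<subseteq> carrier G"
      using that Dc DrQ by (auto simp: F_def X_def)
    then show ?thesis
      by (force simp: image_iff subset_eq)
  qed
  \<comment> \<open>An odd set has a fixed point under an involution. Oddness also gives finiteness
    of \<open>F\<close>, because an infinite set has cardinality 0 here.\<close>
  then obtain C where C: "C \<in> F" "m_inv G ` C = C"
    using even_card_if_involution_no_fixpoint[of F "\<lambda>C. m_inv G ` C"] closed oddF
      card.infinite[of F] by fastforce
  then obtain d where d: "d \<in> D" "C = d <# Q"
    by (auto simp: F_def X_def)
  then have dc: "d \<in> carrier G" and dF: "d <# Q \<in> F"
    using Dc C by auto
  have "inv d \<in> d <# Q"
    using image[OF d(1) dF] C d self_mem_l_coset[OF Q(1), of "inv d"] dc by simp
  then have "inv (inv d \<otimes> inv d) \<in> Q"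
    using mem_l_coset_iff[OF Q(1) dc, of "inv d"] dc by auto
  then have "d \<otimes> d \<in> Q"
    using dc by (simp add: inv_mult_group)
  then show ?thesis
    using norm[OF d(1) dF] d(1) D_def by blast
qed

text \<open>The cardinality hypotheses say that \<open>Q\<close> is a Sylow 2-subgroup of
  \<open>H\<close>. An odd self-inverse double coset contains some \<open>d\<close> that normalises
  \<open>Q\<close> and has its square in \<open>Q\<close>; multiplying \<open>d\<close> on the right
  by an element of \<open>Q\<close> stays in the double coset.\<close>

theorem perfect_code_if_sylow_normaliser_involutions:
  assumes H: "subgroup H G" and fin: "finite (carrier G)"
    and Q: "subgroup Q G" "Q \<subseteq> H" "card Q = 2 ^ n" and odd_index: "card H = card Q * m" "odd m"
    and involution: "\<And>y. \<lbrakk>y \<in> carrier G; y <# Q = Q #> y; y \<otimes> y \<in> Q\<rbrakk>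
      \<Longrightarrow> \<exists>q\<in>Q. (y \<otimes> q) \<otimes> (y \<otimes> q) = \<one>"
  shows "is_perfect_code_of G H"
proof (rule perfect_code_if_odd_double_cosets_contain_involution[OF H fin])
  fix y assume y: "y \<in> carrier G" "inv y \<in> double_coset G H y"
    "odd (card ((\<lambda>x. x <# H) ` double_coset G H y))"
  obtain d where d: "d \<in> double_coset G H y" "d <# Q = Q #> d" "d \<otimes> d \<in> Q"
    using odd_double_coset_meets_normaliser[OF H fin Q odd_index y] by blast
  moreover have "d \<in> carrier G"
    using d double_coset_subset_carrier[OF H y(1)] by blast
  ultimately obtain q where q: "q \<in> Q" "(d \<otimes> q) \<otimes> (d \<otimes> q) = \<one>"
    using involution by blast
  then have "d \<otimes> q \<in> d <# H"
    using Q(2) by (auto simp: l_coset_def)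
  then show "\<exists>z\<in>double_coset G H y. z \<otimes> z = \<one>"
    using q l_coset_subset_double_coset[OF H y(1) d(1)] by blast
qed

end

section \<open>The quadratic extension by a square root of \<open>-1\<close>\<close>

text \<open>The pair \<open>(a, b)\<close> stands for \<open>a + b i\<close> with \<open>i\<close> a
  square root of -1. The points of the affine plane thereby become elements of the quadratic
  extension.\<close>

fun gauss_mult :: "'a::comm_ring_1 \<times> 'a \<Rightarrow> 'a \<times> 'a \<Rightarrow> 'a \<times> 'a" where
  "gauss_mult (a, b) (c, d) = (a * c - b * d, a * d + b * c)"

fun gauss_cnj :: "'a::comm_ring_1 \<times> 'a \<Rightarrow> 'a \<times> 'a" where
  "gauss_cnj (a, b) = (a, - b)"

text \<open>A monoid record, so that Lagrange, Sylow and quotient groups apply once the nonzero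
  elements are known to form a group.\<close>

definition gauss_units :: "('a::comm_ring_1 \<times> 'a) monoid" where
  "gauss_units = \<lparr>carrier = UNIV - {(0, 0)}, monoid.mult = gauss_mult, one = (1, 0)\<rparr>"

lemma carrier_gauss_units [simp]: "carrier gauss_units = UNIV - {(0, 0)}"
  and mult_gauss_units [simp]: "monoid.mult gauss_units = gauss_mult"
  and one_gauss_units [simp]: "monoid.one gauss_units = (1, 0)"
  by (simp_all add: gauss_units_def)

lemma gauss_mult_assoc: "gauss_mult (gauss_mult u v) w = gauss_mult u (gauss_mult v w)"
  by (cases u; cases v; cases w) (simp add: algebra_simps)

lemma gauss_mult_commute: "gauss_mult u v = gauss_mult v u"
  by (cases u; cases v) (simp add: algebra_simps)

lemma gauss_mult_left_commute: "gauss_mult u (gauss_mult v w) = gauss_mult v (gauss_mult u w)"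
  by (metis gauss_mult_assoc gauss_mult_commute)

lemmas gauss_mult_ac = gauss_mult_assoc gauss_mult_commute gauss_mult_left_commute

lemma gauss_mult_simps [simp]:
  "gauss_mult (1, 0) v = v" "gauss_mult v (1, 0) = v" "gauss_mult v (0, 0) = (0, 0)"
  "gauss_mult (0, 0) v = (0, 0)"
  by (cases v; simp)+

lemma gauss_cnj_mult: "gauss_cnj (gauss_mult u v) = gauss_mult (gauss_cnj u) (gauss_cnj v)"
  by (cases u; cases v) (simp add: algebra_simps)

lemma gauss_cnj_cnj [simp]: "gauss_cnj (gauss_cnj u) = u"
  by (cases u) simp

lemma gauss_cnj_eq_0_iff [simp]: "gauss_cnj u = (0, 0) \<longleftrightarrow> u = (0, 0)"
  by (cases u) simp

text \<open>The number \<open>q\<close> is the cardinality of a finite field type, hence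
  automatically a prime power.\<close>

locale three_mod_four_field =
  fixes ty :: "'a::{field, finite} itself"
  assumes card_mod_4: "card (UNIV :: 'a set) mod 4 = 3"
begin

text \<open>In characteristic 2 the map adding 1 is an involution without fixed points, and
  \<open>q\<close> would be even.\<close>

lemma two_neq_0: "(2::'a) \<noteq> 0"
proof
  assume "(2::'a) = 0"
  then have "(x + 1) + 1 = x" for x :: 'a
    by (simp add: add.assoc)
  then have "even (card (UNIV :: 'a set))"
    by (intro even_card_if_involution_no_fixpoint[where f = "\<lambda>x. x + 1"]) auto
  then show False
    using card_mod_4 by presburger
qed

lemma minus_neq_self: "a \<noteq> 0 \<Longrightarrow> - a \<noteq> (a::'a)"
proof
  assume a: "a \<noteq> 0" and "- a = a"
  then have "2 * a = 0"
    by (metis add.right_inverse mult_2)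
  then show False
    using a two_neq_0 by simp
qed

lemma not_four_dvd_card_minus_1: "\<not> 4 dvd card (UNIV :: 'a set) - 1"
  using card_mod_4 by presburger

lemma card_nonzero: "card (UNIV - {0::'a}) = card (UNIV :: 'a set) - 1"
  by (simp add: card_Diff_singleton)

text \<open>Multiplication by a square root of -1 would split the \<open>q - 1\<close> nonzero
  elements into orbits of length four.\<close>

lemma minus_1_not_square: "a * a \<noteq> (-1::'a)"
proof
  assume a: "a * a = -1"
  have sq: "a * (a * x) = - x" for x
    using a by (simp add: mult.assoc[symmetric])
  have "4 dvd card (UNIV - {0::'a})"
    using a sq minus_neq_self by (intro four_dvd_card_if_square_no_fixpoint[where f = "\<lambda>x. a * x"]) auto
  then show False
    using not_four_dvd_card_minus_1 by (simp add: card_nonzero)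
qed

text \<open>The norm form is anisotropic: with \<open>b\<close> nonzero, \<open>a / b\<close> would
  be a square root of -1.\<close>

lemma sum_squares_eq_0_iff: "a * a + b * b = 0 \<longleftrightarrow> a = 0 \<and> (b::'a) = 0"
proof
  assume ab: "a * a + b * b = 0"
  have "b = 0"
  proof (rule ccontr)
    assume b: "b \<noteq> 0"
    have "a * a = - (b * b)"
      using ab by (simp add: eq_neg_iff_add_eq_0)
    then have "(a / b) * (a / b) = -1"
      using b by (simp add: field_simps)
    then show False
      using minus_1_not_square by blast
  qed
  then show "a = 0 \<and> b = 0"
    using ab by simp
qed simp

text \<open>The norm is multiplicative and vanishes only at 0.\<close>

lemma gauss_mult_eq_0_iff: "gauss_mult u v = (0, 0) \<longleftrightarrow> u = (0, 0) \<or> v = ((0::'a), 0)"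
proof
  assume eq: "gauss_mult u v = (0, 0)"
  obtain a b c d where uv: "u = (a, b)" "v = (c, d)"
    by (cases u; cases v)
  have "(a * a + b * b) * (c * c + d * d) = (a * c - b * d) * (a * c - b * d) + (a * d + b * c) * (a * d + b * c)"
    by (simp add: algebra_simps)
  also have "\<dots> = 0"
    using eq uv by simp
  finally show "u = (0, 0) \<or> v = (0, 0)"
    using uv by (simp add: sum_squares_eq_0_iff)
qed auto

lemma comm_group_gauss_units: "comm_group (gauss_units :: ('a \<times> 'a) monoid)"
proof (rule comm_groupI)
  fix x :: "'a \<times> 'a" assume x: "x \<in> carrier gauss_units"
  obtain a b where ab: "x = (a, b)"
    by (cases x)
  \<comment> \<open>The inverse is the conjugate divided by the norm \<open>n\<close>.\<close>
  define n where "n = a * a + b * b"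
  have n: "n \<noteq> 0"
    using x ab by (simp add: n_def sum_squares_eq_0_iff)
  have "gauss_mult (a / n, - b / n) x = (1, 0)"
    using n by (simp add: ab add_divide_distrib[symmetric] n_def[symmetric] mult.commute)
  moreover have "(a / n, - b / n) \<noteq> (0, 0)"
    using n x ab by auto
  ultimately show "\<exists>y\<in>carrier gauss_units. y \<otimes>\<^bsub>gauss_units\<^esub> x = \<one>\<^bsub>gauss_units\<^esub>"
    by (intro bexI[of _ "(a / n, - b / n)"]) auto
qed (simp_all add: gauss_mult_eq_0_iff gauss_mult_ac)

sublocale gauss: comm_group "gauss_units :: ('a \<times> 'a) monoid"
  by (rule comm_group_gauss_units)

lemma gauss_mult_cancel: "gauss_mult u v = gauss_mult u w \<Longrightarrow> u \<noteq> (0, 0) \<Longrightarrow> v = (w :: 'a \<times> 'a)"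
proof -
  assume eq: "gauss_mult u v = gauss_mult u w" and u: "u \<noteq> (0, 0)"
  have "gauss_mult u (fst v - fst w, snd v - snd w) = (0, 0)"
    using eq by (cases u; cases v; cases w) (simp add: algebra_simps)
  then have "(fst v - fst w, snd v - snd w) = (0, 0)"
    using u gauss_mult_eq_0_iff by blast
  then show "v = w"
    by (simp add: prod_eq_iff)
qed

lemma order_gauss_units: "order (gauss_units :: ('a \<times> 'a) monoid) = card (UNIV :: 'a set) ^ 2 - 1"
  by (simp add: order_def card_Diff_singleton power2_eq_square flip: UNIV_Times_UNIV)

lemma gauss_pow_of_base: "a \<noteq> (0::'a) \<Longrightarrow> (a, 0) [^]\<^bsub>gauss_units\<^esub> n = (a ^ n, 0)" for n :: nat
  by (induction n) (simp_all add: mult.commute)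

lemma gauss_cnj_pow:
  "u \<noteq> (0, 0) \<Longrightarrow> gauss_cnj (u [^]\<^bsub>gauss_units\<^esub> n) = gauss_cnj u [^]\<^bsub>gauss_units\<^esub> n"
  for n :: nat and u :: "'a \<times> 'a"
  by (induction n) (simp_all add: gauss_cnj_mult)

section \<open>The 2-part of the unit group\<close>

definition two_exp :: nat where
  "two_exp = multiplicity 2 (card (UNIV :: 'a set) ^ 2 - 1)"

text \<open>The Sylow 2-subgroup of the abelian unit group, described by torsion so that membership
  is an equation stable under conjugation and powers.\<close>

definition two_part :: "('a \<times> 'a) set" where
  "two_part = {u. u \<noteq> (0, 0) \<and> u [^]\<^bsub>gauss_units\<^esub> (2 ^ two_exp :: nat) = (1, 0)}"

definition odd_part :: nat where
  "odd_part = (card (UNIV :: 'a set) ^ 2 - 1) div 2 ^ two_exp"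

lemma card_square_minus_1: "card (UNIV :: 'a set) ^ 2 - 1 = 2 ^ two_exp * odd_part"
  and odd_odd_part: "odd odd_part"
proof -
  have "card (UNIV :: 'a set) \<ge> 2"
    using card_mod_4 by (cases "card (UNIV :: 'a set)") auto
  then have "card (UNIV :: 'a set) ^ 2 - 1 \<noteq> 0"
    using power_mono[of 2 "card (UNIV :: 'a set)" 2] by auto
  then obtain m where "card (UNIV :: 'a set) ^ 2 - 1 = 2 ^ two_exp * m" "odd m"
    using multiplicity_decompose'[of "card (UNIV :: 'a set) ^ 2 - 1" "2::nat"]
    unfolding two_exp_def by auto
  then show "card (UNIV :: 'a set) ^ 2 - 1 = 2 ^ two_exp * odd_part" "odd odd_part"
    by (simp_all add: odd_part_def)
qed

text \<open>Choose \<open>e\<close> divisible by \<open>odd_part\<close> and congruent to 1 modulo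
  \<open>2 ^ two_exp\<close>. Raising to the power \<open>e\<close> is then the projection of the
  unit group onto its 2-part.\<close>

lemma two_power_exponent:
  obtains e where "odd_part dvd e" "\<And>u. u \<noteq> (0, 0) \<Longrightarrow> u [^]\<^bsub>gauss_units\<^esub> (e::nat) \<in> two_part"
    "\<And>u. u \<in> two_part \<Longrightarrow> u [^]\<^bsub>gauss_units\<^esub> e = u"
proof -
  have "coprime odd_part (2 ^ two_exp)"
    using odd_odd_part by simp
  then obtain j where j: "[odd_part * j = 1] (mod 2 ^ two_exp)"
    by (metis One_nat_def cong_solve_coprime_nat)
  define e where "e = odd_part * j"
  have "u [^]\<^bsub>gauss_units\<^esub> e \<in> two_part" if u: "u \<noteq> (0, 0)" for u
  proof -
    have "(u [^]\<^bsub>gauss_units\<^esub> e) [^]\<^bsub>gauss_units\<^esub> (2 ^ two_exp :: nat)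
        = (u [^]\<^bsub>gauss_units\<^esub> order (gauss_units :: ('a \<times> 'a) monoid)) [^]\<^bsub>gauss_units\<^esub> j"
      using u card_square_minus_1 by (simp add: gauss.nat_pow_pow order_gauss_units e_def mult_ac)
    also have "\<dots> = (1, 0)"
      using gauss.pow_order_eq_1[of u] gauss.nat_pow_one u by simp
    finally show ?thesis
      using u gauss.nat_pow_closed[of u e] by (simp add: two_part_def)
  qed
  moreover have "u [^]\<^bsub>gauss_units\<^esub> e = u" if u: "u \<in> two_part" for u
  proof -
    have u': "u \<in> carrier gauss_units" "u [^]\<^bsub>gauss_units\<^esub> (2 ^ two_exp :: nat) = (1, 0)"
      using u by (auto simp: two_part_def)
    have red: "u [^]\<^bsub>gauss_units\<^esub> i = u [^]\<^bsub>gauss_units\<^esub> (i mod 2 ^ two_exp)" for i :: nat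
    proof -
      have "u [^]\<^bsub>gauss_units\<^esub> i = u [^]\<^bsub>gauss_units\<^esub> (2 ^ two_exp * (i div 2 ^ two_exp) + i mod 2 ^ two_exp)"
        by simp
      also have "\<dots> = (u [^]\<^bsub>gauss_units\<^esub> (2 ^ two_exp :: nat)) [^]\<^bsub>gauss_units\<^esub> (i div 2 ^ two_exp)
          \<otimes>\<^bsub>gauss_units\<^esub> u [^]\<^bsub>gauss_units\<^esub> (i mod 2 ^ two_exp)"
        using u'(1) by (simp only: gauss.nat_pow_mult[symmetric] gauss.nat_pow_pow)
      also have "\<dots> = u [^]\<^bsub>gauss_units\<^esub> (i mod 2 ^ two_exp)"
        using u' gauss.nat_pow_one[of "i div 2 ^ two_exp"] by simp
      finally show ?thesis .
    qed
    have "u [^]\<^bsub>gauss_units\<^esub> e = u [^]\<^bsub>gauss_units\<^esub> (1::nat)"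
      using red[of e] red[of 1] j by (simp only: cong_def e_def)
    then show ?thesis
      using u'(1) gauss.nat_pow_eone[of u] by simp
  qed
  moreover have "odd_part dvd e"
    by (simp add: e_def)
  ultimately show ?thesis
    using that by blast
qed

lemma subgroup_two_part: "subgroup two_part gauss_units"
proof (rule gauss.subgroupI)
  show "two_part \<subseteq> carrier gauss_units"
    by (auto simp: two_part_def)
  show "two_part \<noteq> {}"
  proof -
    have "(1, 0) \<in> two_part"
      using gauss.nat_pow_one by (simp add: two_part_def)
    then show ?thesis by blast
  qed
  show "inv\<^bsub>gauss_units\<^esub> a \<in> two_part" if "a \<in> two_part" for a
    using that gauss.nat_pow_inv[of a "2 ^ two_exp"] gauss.inv_closed[of a] gauss.inv_one
    by (simp add: two_part_def)
  show "a \<otimes>\<^bsub>gauss_units\<^esub> b \<in> two_part" if "a \<in> two_part" "b \<in> two_part" for a b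
    using that gauss.nat_pow_distrib[of a b "2 ^ two_exp"]
    by (simp add: two_part_def gauss_mult_eq_0_iff)
qed

text \<open>Compare with a Sylow subgroup \<open>P\<close>. By Lagrange, \<open>P\<close> lies in
  \<open>two_part\<close>. Conversely, an element of \<open>two_part\<close> is a power of its own
  power with exponent \<open>odd_part\<close>, and the latter is in \<open>P\<close> because the
  quotient by \<open>P\<close> has order \<open>odd_part\<close>.\<close>

lemma card_two_part: "card two_part = 2 ^ two_exp"
proof -
  obtain P :: "('a \<times> 'a) set" where P: "subgroup P gauss_units" "card P = 2 ^ two_exp"
    using sylow_thm[of 2 "gauss_units :: ('a \<times> 'a) monoid" two_exp odd_part] card_square_minus_1 gauss.is_group
    by (auto simp: order_gauss_units)
  interpret P: subgroup P "gauss_units :: ('a \<times> 'a) monoid" by fact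
  have "P \<subseteq> two_part"
  proof
    fix u assume u: "u \<in> P"
    interpret PG: group "gauss_units\<lparr>carrier := P\<rparr>"
      using P.subgroup_is_group[OF gauss.is_group] .
    have "u [^]\<^bsub>gauss_units\<lparr>carrier := P\<rparr>\<^esub> order (gauss_units\<lparr>carrier := P\<rparr>) = \<one>\<^bsub>gauss_units\<lparr>carrier := P\<rparr>\<^esub>"
      using PG.pow_order_eq_1[of u] u by simp
    then show "u \<in> two_part"
      using u P.mem_carrier[OF u] P(2) by (simp add: two_part_def order_def gauss.nat_pow_consistent[symmetric])
  qed
  moreover have "two_part \<subseteq> P"
  proof
    fix u assume u: "u \<in> two_part"
    have uc: "u \<in> carrier gauss_units"
      using u by (auto simp: two_part_def)
    obtain e j where "e = odd_part * j" and e: "u [^]\<^bsub>gauss_units\<^esub> e = u"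
      using two_power_exponent u by (metis dvdE)
    then have u_eq: "u = (u [^]\<^bsub>gauss_units\<^esub> odd_part) [^]\<^bsub>gauss_units\<^esub> j"
      using gauss.nat_pow_pow[OF uc] by simp
    interpret N: normal P "gauss_units :: ('a \<times> 'a) monoid"
      using gauss.subgroup_imp_normal[OF P(1)] .
    interpret M: group "(gauss_units :: ('a \<times> 'a) monoid) Mod P"
      by (rule N.factorgroup_is_group)
    have "card (rcosets\<^bsub>gauss_units\<^esub> P) = odd_part"
      using gauss.lagrange[OF P(1)] P(2) card_square_minus_1 by (simp add: order_gauss_units)
    then have "order ((gauss_units :: ('a \<times> 'a) monoid) Mod P) = odd_part"
      by (simp add: order_def FactGroup_def)
    moreover have "P #>\<^bsub>gauss_units\<^esub> u \<in> carrier (gauss_units Mod P)"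
      using uc by (auto simp: carrier_FactGroup)
    ultimately have "(P #>\<^bsub>gauss_units\<^esub> u) [^]\<^bsub>gauss_units Mod P\<^esub> odd_part = P"
      using M.pow_order_eq_1 by force
    then have "P #>\<^bsub>gauss_units\<^esub> (u [^]\<^bsub>gauss_units\<^esub> odd_part) = P"
      using N.FactGroup_pow[OF uc] by simp
    then have "u [^]\<^bsub>gauss_units\<^esub> odd_part \<in> P"
      using gauss.coset_join1[OF _ _ P(1)] uc gauss.nat_pow_closed[OF uc] by blast
    then show "u \<in> P"
      using u_eq gauss.subgroup_int_pow_closed[OF P(1)] by (metis int_pow_int)
  qed
  ultimately show ?thesis
    using P by (metis subset_antisym)
qed

text \<open>Hilbert 90 produces \<open>w\<close> among all units; raising it to a power that is the identity on
  \<^term>\<open>two_part\<close> moves it into \<^term>\<open>two_part\<close>.\<close>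

lemma hilbert_90_two_part:
  assumes u: "u \<in> two_part" and norm: "gauss_mult u (gauss_cnj u) = (1, 0)"
  obtains w where "w \<in> two_part" "gauss_mult u (gauss_cnj w) = w"
proof -
  obtain a b where ab: "u = (a, b)"
    by (cases u)
  \<comment> \<open>When \<open>u\<close> has norm 1, \<open>1 + u\<close> is a solution; it
    vanishes only for \<open>u = -1\<close>, and then \<open>i\<close> is a solution.\<close>
  obtain w where w: "w \<noteq> (0, 0)" "gauss_mult u (gauss_cnj w) = w"
  proof (cases "u = (-1, 0)")
    case True
    then show ?thesis
      by (intro that[of "(0, 1)"]) auto
  next
    case False
    have "gauss_mult u (gauss_cnj (1 + a, b)) = (1 + a, b)"
      using norm by (simp add: ab algebra_simps)
    moreover have "(1 + a, b) \<noteq> (0, 0)"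
      using False by (auto simp: ab eq_neg_iff_add_eq_0 add.commute)
    ultimately show ?thesis
      using that by blast
  qed
  obtain e where e: "\<And>u. u \<noteq> (0, 0) \<Longrightarrow> u [^]\<^bsub>gauss_units\<^esub> (e::nat) \<in> two_part"
    "\<And>u. u \<in> two_part \<Longrightarrow> u [^]\<^bsub>gauss_units\<^esub> e = u"
    using two_power_exponent by metis
  have u0: "u \<noteq> (0, 0)"
    using u by (simp add: two_part_def)
  have "w [^]\<^bsub>gauss_units\<^esub> e = (gauss_mult u (gauss_cnj w)) [^]\<^bsub>gauss_units\<^esub> e"
    using w(2) by simp
  also have "\<dots> = gauss_mult (u [^]\<^bsub>gauss_units\<^esub> e) (gauss_cnj w [^]\<^bsub>gauss_units\<^esub> e)"
    using gauss.nat_pow_distrib[of u "gauss_cnj w" e] u0 w(1) by simp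
  also have "\<dots> = gauss_mult u (gauss_cnj (w [^]\<^bsub>gauss_units\<^esub> e))"
    using e(2)[OF u] gauss_cnj_pow[OF w(1)] by simp
  finally show ?thesis
    using that[OF e(1)[OF w(1)]] by simp
qed

text \<open>By induction the square of \<open>a\<close> is 1 or -1, and -1 is not a square.\<close>

lemma power_two_eq_1: "a ^ (2 ^ n) = 1 \<Longrightarrow> a = 1 \<or> a = (-1::'a)"
proof (induction n arbitrary: a)
  case (Suc n)
  then have "(a * a) ^ (2 ^ n) = 1"
    by (simp add: power_mult power2_eq_square)
  then have "a * a = 1"
    using Suc.IH minus_1_not_square by blast
  then show ?case
    using square_eq_1_iff by blast
qed simp

text \<open>Self-conjugate elements lie in the base field, whose only roots of unity of 2-power
  order are 1 and -1.\<close>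

lemma two_part_self_conjugate:
  assumes "u \<in> two_part" "gauss_cnj u = u"
  shows "u = (1, 0) \<or> u = (-1, 0)"
proof -
  obtain a b where ab: "u = (a, b)"
    by (cases u)
  have b: "b = 0"
    using assms(2) minus_neq_self[of b] by (auto simp: ab)
  then have "a \<noteq> 0" "a ^ (2 ^ two_exp) = 1"
    using assms(1) gauss_pow_of_base[of a "2 ^ two_exp"] by (auto simp: ab two_part_def)
  then show ?thesis
    using power_two_eq_1 ab b by blast
qed

lemma gauss_square_eq_1: "gauss_mult u u = (1, 0) \<Longrightarrow> u = (1, 0) \<or> u = (- 1 :: 'a, 0)"
proof -
  assume u: "gauss_mult u u = (1, 0)"
  obtain a b where ab: "u = (a, b)"
    by (cases u)
  have "gauss_mult (a - 1, b) (a + 1, b) = (0, 0)"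
    using u by (simp add: ab algebra_simps)
  then show ?thesis
    using gauss_mult_eq_0_iff by (fastforce simp: ab eq_neg_iff_add_eq_0)
qed

lemma gauss_cnj_two_part: "u \<in> two_part \<Longrightarrow> gauss_cnj u \<in> two_part"
  using gauss_cnj_pow[of u "2 ^ two_exp", symmetric] by (auto simp: two_part_def)

lemma minus_1_two_part: "(-1, 0) \<in> two_part"
proof -
  have "card (UNIV :: 'a set) mod 2 = 1"
    using card_mod_4 by presburger
  then have "even (card (UNIV :: 'a set) ^ 2 - 1)"
    by (simp add: odd_iff_mod_2_eq_one)
  then have "two_exp \<noteq> 0"
    using card_square_minus_1 odd_odd_part by (metis mult_1 power_0)
  then show ?thesis
    using gauss_pow_of_base[of "-1" "2 ^ two_exp"] by (simp add: two_part_def)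
qed

end

section \<open>A Sylow 2-subgroup of the affine group\<close>

lemma bij_carrier_BijGroup_UNIV: "carrier (BijGroup UNIV) = {f. bij f}"
  by (auto simp: BijGroup_def Bij_def)

lemma mult_BijGroup_UNIV: "bij f \<Longrightarrow> bij g \<Longrightarrow> f \<otimes>\<^bsub>BijGroup UNIV\<^esub> g = f \<circ> g"
  by (simp add: BijGroup_def Bij_def compose_def fun_eq_iff)

lemma one_BijGroup_UNIV: "\<one>\<^bsub>BijGroup UNIV\<^esub> = id"
  by (simp add: BijGroup_def fun_eq_iff)

text \<open>A two-sided inverse inside \<open>H\<close> also yields bijectivity, so this needs no
  separate check.\<close>

lemma subgroup_BijGroup_UNIVI:
  assumes "id \<in> H" "\<And>f g. f \<in> H \<Longrightarrow> g \<in> H \<Longrightarrow> f \<circ> g \<in> H"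
    and ex: "\<And>f. f \<in> H \<Longrightarrow> \<exists>g\<in>H. f \<circ> g = id \<and> g \<circ> f = id"
  shows "subgroup H (BijGroup UNIV)"
proof -
  interpret G: group "BijGroup UNIV"
    by (rule group_BijGroup)
  have bij: "bij f" if "f \<in> H" for f
    using ex[OF that] o_bij by blast
  show ?thesis
  proof (rule G.subgroupI)
    show "H \<subseteq> carrier (BijGroup UNIV)"
      using bij by (auto simp: bij_carrier_BijGroup_UNIV)
    show "H \<noteq> {}"
      using assms(1) by blast
    show "f \<otimes>\<^bsub>BijGroup UNIV\<^esub> g \<in> H" if "f \<in> H" "g \<in> H" for f g
      using that assms(2) bij by (simp add: mult_BijGroup_UNIV)
    fix f assume f: "f \<in> H"
    obtain g where g: "g \<in> H" "g \<circ> f = id"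
      using ex[OF f] by blast
    then have "inv\<^bsub>BijGroup UNIV\<^esub> f = g"
      using f bij by (intro G.inv_equality)
        (auto simp: bij_carrier_BijGroup_UNIV mult_BijGroup_UNIV one_BijGroup_UNIV)
    then show "inv\<^bsub>BijGroup UNIV\<^esub> f \<in> H"
      using g by simp
  qed
qed

section \<open>The affine group\<close>

lemma AGL2I:
  assumes "a * d - b * c \<noteq> 0" "\<And>x y. f (x, y) = (a * x + b * y + e1, c * x + d * y + e2)"
  shows "f \<in> AGL2"
proof -
  have "f = (\<lambda>(x, y). (a * x + b * y + e1, c * x + d * y + e2))"
    using assms(2) by (simp add: fun_eq_iff)
  then show ?thesis
    using assms(1) unfolding AGL2_def by blast
qed

lemma AGL2E:
  assumes "f \<in> AGL2"
  obtains a b c d e1 e2 where "a * d - b * c \<noteq> 0"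
    "\<And>x y. f (x, y) = (a * x + b * y + e1, c * x + d * y + e2)"
  using assms unfolding AGL2_def by auto

text \<open>Composition multiplies the determinants, and Cramer's rule gives an affine
  inverse.\<close>

lemma subgroup_AGL2: "subgroup (AGL2 :: ('a::field \<times> 'a \<Rightarrow> 'a \<times> 'a) set) (BijGroup UNIV)"
proof (rule subgroup_BijGroup_UNIVI)
  show "id \<in> (AGL2 :: ('a \<times> 'a \<Rightarrow> 'a \<times> 'a) set)"
    by (rule AGL2I[of 1 1 0 0 _ 0 0]) auto
next
  fix f g :: "'a \<times> 'a \<Rightarrow> 'a \<times> 'a" assume "f \<in> AGL2" "g \<in> AGL2"
  obtain a b c d e1 e2 where f: "a * d - b * c \<noteq> 0"
    "\<And>x y. f (x, y) = (a * x + b * y + e1, c * x + d * y + e2)"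
    using \<open>f \<in> AGL2\<close> by (rule AGL2E) blast
  obtain a' b' c' d' e1' e2' where g: "a' * d' - b' * c' \<noteq> 0"
    "\<And>x y. g (x, y) = (a' * x + b' * y + e1', c' * x + d' * y + e2')"
    using \<open>g \<in> AGL2\<close> by (rule AGL2E) blast
  have "(a * a' + b * c') * (c * b' + d * d') - (a * b' + b * d') * (c * a' + d * c')
      = (a * d - b * c) * (a' * d' - b' * c')"
    by (simp add: algebra_simps)
  also have "\<dots> \<noteq> 0"
    using f(1) g(1) by simp
  finally show "f \<circ> g \<in> AGL2"
    by (rule AGL2I[where ?e1.0 = "a * e1' + b * e2' + e1" and ?e2.0 = "c * e1' + d * e2' + e2"])
      (simp add: f(2) g(2) algebra_simps)
next
  fix f :: "'a \<times> 'a \<Rightarrow> 'a \<times> 'a" assume "f \<in> AGL2"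
  then obtain a b c d e1 e2 where f: "a * d - b * c \<noteq> 0"
    "\<And>x y. f (x, y) = (a * x + b * y + e1, c * x + d * y + e2)"
    by (rule AGL2E) blast
  define D where "D = a * d - b * c"
  have D: "D \<noteq> 0"
    using f by (simp add: D_def)
  define g where "g = (\<lambda>(x, y). ((d * (x - e1) - b * (y - e2)) / D, (a * (y - e2) - c * (x - e1)) / D))"
  have "g \<in> AGL2"
  proof (rule AGL2I)
    show "(d / D) * (a / D) - (- b / D) * (- c / D) \<noteq> 0"
    proof -
      have "(d / D) * (a / D) - (- b / D) * (- c / D) = 1 / D"
        using D by (simp add: field_simps) (simp add: D_def algebra_simps)
      then show ?thesis
        using D by simp
    qed
    show "g (x, y) = (d / D * x + - b / D * y + (b * e2 - d * e1) / D,
        - c / D * x + a / D * y + (c * e1 - a * e2) / D)" for x y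
      using D by (simp add: g_def field_simps)
  qed
  moreover have "f (g (x, y)) = (x, y)" for x y
  proof -
    have "a * (d * (x - e1) - b * (y - e2)) + b * (a * (y - e2) - c * (x - e1)) = D * (x - e1)"
      "c * (d * (x - e1) - b * (y - e2)) + d * (a * (y - e2) - c * (x - e1)) = D * (y - e2)"
      by (simp_all add: D_def algebra_simps)
    then show ?thesis
      using D by (simp add: g_def f(2) add_divide_distrib[symmetric])
  qed
  moreover have "g (f (x, y)) = (x, y)" for x y
  proof -
    have "d * (a * x + b * y) - b * (c * x + d * y) = D * x"
      "a * (c * x + d * y) - c * (a * x + b * y) = D * y"
      by (simp_all add: D_def algebra_simps)
    then show ?thesis
      using D by (simp add: g_def f(2))
  qed
  ultimately show "\<exists>g\<in>AGL2. f \<circ> g = id \<and> g \<circ> f = id"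
    by (intro bexI[of _ g]) (auto simp: fun_eq_iff)
qed

context three_mod_four_field
begin

text \<open>Every affine map is uniquely \<open>(x, y) \<mapsto> u (x + s y, t y) + e\<close> with the multiplication by a
  nonzero \<open>u\<close> of the quadratic extension.\<close>

lemma card_AGL2:
  "card (AGL2 :: ('a \<times> 'a \<Rightarrow> 'a \<times> 'a) set)
    = (card (UNIV :: 'a set) ^ 2 - 1) * (card (UNIV :: 'a set) * (card (UNIV :: 'a set) - 1))
      * card (UNIV :: 'a set) ^ 2"
proof -
  let ?P = "((UNIV - {(0, 0)}) \<times> (UNIV \<times> (UNIV - {0}))) \<times> UNIV
    :: ((('a \<times> 'a) \<times> ('a \<times> 'a)) \<times> ('a \<times> 'a)) set"
  define \<Phi> :: "(('a \<times> 'a) \<times> ('a \<times> 'a)) \<times> ('a \<times> 'a) \<Rightarrow> 'a \<times> 'a \<Rightarrow> 'a \<times> 'a"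
    where "\<Phi> = (\<lambda>((u, (s, t)), (e1, e2)) (x, y).
      (fst (gauss_mult u (x + s * y, t * y)) + e1, snd (gauss_mult u (x + s * y, t * y)) + e2))"
  have "inj_on \<Phi> ?P"
  proof (rule inj_onI)
    fix p p' assume p: "p \<in> ?P" "p' \<in> ?P" "\<Phi> p = \<Phi> p'"
    obtain u s t e1 e2 where P: "p = ((u, (s, t)), (e1, e2))"
      by (metis surj_pair)
    obtain u' s' t' e1' e2' where P': "p' = ((u', (s', t')), (e1', e2'))"
      by (metis surj_pair)
    \<comment> \<open>The value at the origin determines the translation, the value at
      \<open>(1, 0)\<close> then determines \<open>u\<close>, and the value at \<open>(0, 1)\<close>
      determines the product of \<open>u\<close> with \<open>(s, t)\<close>.\<close>
    have "\<Phi> p (0, 0) = \<Phi> p' (0, 0)" "\<Phi> p (1, 0) = \<Phi> p' (1, 0)" "\<Phi> p (0, 1) = \<Phi> p' (0, 1)"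
      using p(3) by simp_all
    then have e: "e1 = e1'" "e2 = e2'" and u: "u = u'"
      and "gauss_mult u (s, t) = gauss_mult u' (s', t')"
      by (auto simp: P P' \<Phi>_def prod_eq_iff)
    moreover have "u \<noteq> (0, 0)"
      using p(1) P by simp
    ultimately have "(s, t) = (s', t')"
      by (metis gauss_mult_cancel)
    then show "p = p'"
      using e u P P' by simp
  qed
  moreover have "\<Phi> ` ?P = AGL2"
  proof
    show "\<Phi> ` ?P \<subseteq> AGL2"
    proof
      fix f assume "f \<in> \<Phi> ` ?P"
      then obtain a c s t e1 e2 where f: "f = \<Phi> (((a, c), (s, t)), (e1, e2))" "(a, c) \<noteq> (0, 0)" "t \<noteq> 0"
        by fastforce
      have "a * (c * s + a * t) - (a * s - c * t) * c = t * (a * a + c * c)"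
        by (simp add: algebra_simps)
      also have "\<dots> \<noteq> 0"
        using f by (simp add: sum_squares_eq_0_iff)
      finally show "f \<in> AGL2"
        by (rule AGL2I[where ?e1.0 = e1 and ?e2.0 = e2]) (simp add: f(1) \<Phi>_def algebra_simps)
    qed
    show "AGL2 \<subseteq> \<Phi> ` ?P"
    proof
      fix f :: "'a \<times> 'a \<Rightarrow> 'a \<times> 'a" assume "f \<in> AGL2"
      then obtain a b c d e1 e2 where f: "a * d - b * c \<noteq> 0"
        "\<And>x y. f (x, y) = (a * x + b * y + e1, c * x + d * y + e2)"
        by (rule AGL2E) blast
      define n where "n = a * a + c * c"
      have n: "n \<noteq> 0"
        using f(1) by (auto simp: n_def sum_squares_eq_0_iff)
      \<comment> \<open>The pair \<open>(s, t)\<close> is the quotient of \<open>(b, d)\<close> by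
        \<open>u = (a, c)\<close>: the product of \<open>(b, d)\<close> with the conjugate of
        \<open>u\<close>, divided by the norm \<open>n\<close>.\<close>
      define s where "s = (a * b + c * d) / n"
      define t where "t = (a * d - b * c) / n"
      have "a * s - c * t = (a * (a * b + c * d) - c * (a * d - b * c)) / n"
        using n by (simp add: s_def t_def field_simps)
      also have "a * (a * b + c * d) - c * (a * d - b * c) = b * n"
        by (simp add: n_def algebra_simps)
      finally have b: "a * s - c * t = b"
        using n by simp
      have "c * s + a * t = (c * (a * b + c * d) + a * (a * d - b * c)) / n"
        using n by (simp add: s_def t_def field_simps)
      also have "c * (a * b + c * d) + a * (a * d - b * c) = d * n"
        by (simp add: n_def algebra_simps)
      finally have d: "c * s + a * t = d"
        using n by simp
      have "f = \<Phi> (((a, c), (s, t)), (e1, e2))"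
        by (auto simp: fun_eq_iff f(2) \<Phi>_def b[symmetric] d[symmetric] algebra_simps)
      moreover have "(((a, c), (s, t)), (e1, e2)) \<in> ?P"
        using f(1) n by (auto simp: t_def)
      ultimately show "f \<in> \<Phi> ` ?P"
        by blast
    qed
  qed
  ultimately have "card (AGL2 :: ('a \<times> 'a \<Rightarrow> 'a \<times> 'a) set) = card ?P"
    using card_image by metis
  also have "\<dots> = card (UNIV - {(0, 0) :: 'a \<times> 'a}) * (card (UNIV :: 'a set) * card (UNIV - {0 :: 'a}))
      * card (UNIV :: ('a \<times> 'a) set)"
    by (simp only: card_cartesian_product)
  also have "card (UNIV :: ('a \<times> 'a) set) = card (UNIV :: 'a set) ^ 2"
    by (simp add: power2_eq_square flip: UNIV_Times_UNIV)
  also have "card (UNIV - {(0, 0) :: 'a \<times> 'a}) = card (UNIV :: 'a set) ^ 2 - 1"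
    using order_gauss_units by (simp add: order_def)
  finally show ?thesis
    by (simp only: card_nonzero)
qed

text \<open>The multiplications by \<open>two_part\<close>, extended by conjugation. This is the
  semidihedral Sylow 2-subgroup of the linear group of the plane.\<close>

definition semidihedral :: "('a \<times> 'a \<Rightarrow> 'a \<times> 'a) set" where
  "semidihedral = gauss_mult ` two_part \<union> (\<lambda>u v. gauss_mult u (gauss_cnj v)) ` two_part"

lemma semidihedral_cases [consumes 1, case_names rotation reflection]:
  assumes "f \<in> semidihedral"
  obtains u where "u \<in> two_part" "\<And>v. f v = gauss_mult u v"
  | u where "u \<in> two_part" "\<And>v. f v = gauss_mult u (gauss_cnj v)"
  using assms by (auto simp: semidihedral_def)

lemma rotation_in_semidihedral:
  "u \<in> two_part \<Longrightarrow> (\<And>v. f v = gauss_mult u v) \<Longrightarrow> f \<in> semidihedral"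
  by (auto simp: semidihedral_def image_iff fun_eq_iff)

lemma reflection_in_semidihedral:
  "u \<in> two_part \<Longrightarrow> (\<And>v. f v = gauss_mult u (gauss_cnj v)) \<Longrightarrow> f \<in> semidihedral"
  by (auto simp: semidihedral_def image_iff fun_eq_iff)

lemma one_two_part: "(1, 0) \<in> two_part"
  using subgroup.one_closed[OF subgroup_two_part] by simp

lemma mult_two_part: "u \<in> two_part \<Longrightarrow> v \<in> two_part \<Longrightarrow> gauss_mult u v \<in> two_part"
  using subgroup.m_closed[OF subgroup_two_part] by simp

lemma comp_semidihedral:
  assumes "f \<in> semidihedral" "g \<in> semidihedral"
  shows "f \<circ> g \<in> semidihedral"
  using assms(1)
proof (cases rule: semidihedral_cases)
  case f: (rotation u)
  from assms(2) show ?thesis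
  proof (cases rule: semidihedral_cases)
    case g: (rotation v)
    show ?thesis
      by (rule rotation_in_semidihedral[OF mult_two_part[OF f(1) g(1)]])
        (simp add: f g gauss_mult_assoc)
  next
    case g: (reflection v)
    show ?thesis
      by (rule reflection_in_semidihedral[OF mult_two_part[OF f(1) g(1)]])
        (simp add: f g gauss_mult_assoc)
  qed
next
  case f: (reflection u)
  from assms(2) show ?thesis
  proof (cases rule: semidihedral_cases)
    case g: (rotation v)
    show ?thesis
      by (rule reflection_in_semidihedral[OF mult_two_part[OF f(1) gauss_cnj_two_part[OF g(1)]]])
        (simp add: f g gauss_mult_assoc gauss_cnj_mult)
  next
    case g: (reflection v)
    show ?thesis
      by (rule rotation_in_semidihedral[OF mult_two_part[OF f(1) gauss_cnj_two_part[OF g(1)]]])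
        (simp add: f g gauss_mult_assoc gauss_cnj_mult)
  qed
qed

lemma subgroup_semidihedral: "subgroup semidihedral (BijGroup UNIV)"
proof (rule subgroup_BijGroup_UNIVI)
  show "id \<in> semidihedral"
    by (rule rotation_in_semidihedral[OF one_two_part]) simp
  show "f \<circ> g \<in> semidihedral" if "f \<in> semidihedral" "g \<in> semidihedral" for f g
    using that by (rule comp_semidihedral)
  fix f assume "f \<in> semidihedral"
  then show "\<exists>g\<in>semidihedral. f \<circ> g = id \<and> g \<circ> f = id"
  proof (cases rule: semidihedral_cases)
    case f: (rotation u)
    obtain v where v: "v \<in> two_part" "gauss_mult u v = (1, 0)"
      using subgroup.m_inv_closed[OF subgroup_two_part f(1)] gauss.r_inv[of u] f(1)
      by (auto simp: two_part_def)
    have "gauss_mult v \<in> semidihedral"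
      by (rule rotation_in_semidihedral[OF v(1)]) simp
    moreover have "f \<circ> gauss_mult v = id" "gauss_mult v \<circ> f = id"
      using v(2) gauss_mult_commute[of u v] by (auto simp: fun_eq_iff f gauss_mult_assoc[symmetric]
          simp del: gauss_mult.simps)
    ultimately show ?thesis by blast
  next
    case f: (reflection u)
    obtain v where v: "v \<in> two_part" "gauss_mult u v = (1, 0)"
      using subgroup.m_inv_closed[OF subgroup_two_part f(1)] gauss.r_inv[of u] f(1)
      by (auto simp: two_part_def)
    \<comment> \<open>The reflection with factor \<open>u\<close> is inverted by the reflection
      whose factor is the conjugate of the inverse of \<open>u\<close>.\<close>
    let ?g = "\<lambda>w. gauss_mult (gauss_cnj v) (gauss_cnj w)"
    have "?g \<in> semidihedral"
      by (rule reflection_in_semidihedral[OF gauss_cnj_two_part[OF v(1)]]) simp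
    moreover have "gauss_mult (gauss_cnj v) (gauss_cnj u) = (1, 0)"
      using v(2) gauss_cnj_mult[of u v] gauss_mult_commute by simp
    then have "f \<circ> ?g = id" "?g \<circ> f = id"
      using v(2) by (auto simp: fun_eq_iff f gauss_cnj_mult gauss_mult_assoc[symmetric]
          simp del: gauss_mult.simps gauss_cnj.simps)
    ultimately show ?thesis by blast
  qed
qed

text \<open>The value at 1 recovers the factor \<open>u\<close>. A rotation and a reflection that
  agree at 1 have the same factor and then differ at \<open>i\<close>.\<close>

lemma card_semidihedral: "card semidihedral = 2 ^ Suc two_exp"
proof -
  have inj1: "inj_on gauss_mult two_part"
  proof (rule inj_onI)
    fix u v :: "'a \<times> 'a" assume "gauss_mult u = gauss_mult v"
    then have "gauss_mult u (1, 0) = gauss_mult v (1, 0)"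
      by simp
    then show "u = v" by simp
  qed
  have inj2: "inj_on (\<lambda>u v. gauss_mult u (gauss_cnj v)) two_part"
  proof (rule inj_onI)
    fix u v :: "'a \<times> 'a"
    assume "(\<lambda>w. gauss_mult u (gauss_cnj w)) = (\<lambda>w. gauss_mult v (gauss_cnj w))"
    then have "gauss_mult u (gauss_cnj (1, 0)) = gauss_mult v (gauss_cnj (1, 0))"
      by meson
    then show "u = v" by simp
  qed
  have "gauss_mult u \<noteq> (\<lambda>w. gauss_mult v (gauss_cnj w))" if "u \<in> two_part" for u v
  proof
    assume eq: "gauss_mult u = (\<lambda>w. gauss_mult v (gauss_cnj w))"
    then have "gauss_mult u (1, 0) = gauss_mult v (gauss_cnj (1, 0))"
      by meson
    then have "u = v"
      by simp
    moreover have "gauss_mult u (0, 1) = gauss_mult v (gauss_cnj (0, 1))"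
      using eq by meson
    moreover have "u \<noteq> (0, 0)"
      using that by (simp add: two_part_def)
    ultimately have "(0, 1) = gauss_cnj (0 :: 'a, 1)"
      by (metis gauss_mult_cancel)
    then show False
      using minus_neq_self[of 1] by simp
  qed
  then have "gauss_mult ` two_part \<inter> (\<lambda>u v. gauss_mult u (gauss_cnj v)) ` two_part = {}"
    by blast
  moreover have "finite two_part"
    by (rule finite)
  ultimately show ?thesis
    unfolding semidihedral_def
    by (subst card_Un_disjoint) (simp_all add: card_image[OF inj1] card_image[OF inj2] card_two_part)
qed

lemma semidihedral_subset_AGL2: "semidihedral \<subseteq> AGL2"
proof
  fix f assume "f \<in> semidihedral"
  then show "f \<in> AGL2"
  proof (cases rule: semidihedral_cases)
    case f: (rotation u)
    obtain a b where ab: "u = (a, b)"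
      by (cases u)
    have "a * a - (- b) * b \<noteq> 0"
      using f(1) sum_squares_eq_0_iff by (auto simp: ab two_part_def)
    then show ?thesis
      by (rule AGL2I[where ?e1.0 = 0 and ?e2.0 = 0]) (simp add: f ab algebra_simps)
  next
    case f: (reflection u)
    obtain a b where ab: "u = (a, b)"
      by (cases u)
    have "a * (- a) - b * b = - (a * a + b * b)"
      by simp
    moreover have "a * a + b * b \<noteq> 0"
      using f(1) sum_squares_eq_0_iff[of a b] by (auto simp: ab two_part_def)
    ultimately have "a * (- a) - b * b \<noteq> 0"
      by (metis neg_equal_0_iff_equal)
    then show ?thesis
      by (rule AGL2I[where ?e1.0 = 0 and ?e2.0 = 0]) (simp add: f ab algebra_simps)
  qed
qed

text \<open>The affine group has order \<open>(q^2 - 1) q (q - 1) q^2\<close>. The first factor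
  contributes \<open>2 ^ two_exp\<close>, the factor \<open>q - 1\<close> contributes exactly one
  further 2, and \<open>q\<close> is odd.\<close>

lemma odd_index_semidihedral:
  obtains m where "card (AGL2 :: ('a \<times> 'a \<Rightarrow> 'a \<times> 'a) set) = card semidihedral * m" "odd m"
proof -
  let ?q = "card (UNIV :: 'a set)"
  obtain r where r: "?q = 4 * r + 3"
    using card_mod_4 by (metis mult_div_mod_eq)
  have "?q - 1 = 2 * (2 * r + 1)"
    using r by simp
  then have "card (AGL2 :: ('a \<times> 'a \<Rightarrow> 'a \<times> 'a) set)
      = card semidihedral * (odd_part * ?q * (2 * r + 1) * ?q ^ 2)"
    by (simp only: card_AGL2 card_square_minus_1 card_semidihedral power_Suc mult_ac)
  moreover have "odd (odd_part * ?q * (2 * r + 1) * ?q ^ 2)"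
    using odd_odd_part r by simp
  ultimately show ?thesis
    using that by blast
qed

text \<open>A rotation of square 1 has factor 1 or -1. A reflection of square 1 has a factor of norm
  1, so Hilbert 90 gives a fixed vector \<open>w\<close> in \<open>two_part\<close>, and
  multiplication by \<open>w\<close> conjugates \<open>gauss_cnj\<close> into the
  reflection.\<close>

lemma involution_semidihedral_cases:
  assumes f: "f \<in> semidihedral" and invol: "\<And>v. f (f v) = v"
  obtains "\<And>v. f v = v" | "\<And>v. f v = gauss_mult (-1, 0) v"
  | u w where "u \<in> two_part" "w \<in> two_part" "gauss_mult u (gauss_cnj w) = w"
      "\<And>v. f v = gauss_mult u (gauss_cnj v)"
  using f
proof (cases rule: semidihedral_cases)
  case u: (rotation u)
  have "gauss_mult u u = (1, 0)"
    using invol[of "(1, 0)"] u(2) by simp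
  then consider "u = (1, 0)" | "u = (-1, 0)"
    using gauss_square_eq_1 by blast
  then show ?thesis
    using that(1,2) u(2) by cases simp_all
next
  case u: (reflection u)
  have "gauss_mult u (gauss_cnj u) = (1, 0)"
    using invol[of "(1, 0)"] u(2) by simp
  then obtain w where "w \<in> two_part" "gauss_mult u (gauss_cnj w) = w"
    using hilbert_90_two_part u(1) by blast
  then show ?thesis
    using that(3) u by blast
qed

text \<open>The permutation \<open>y\<close> need not be linear; all information about it comes from
  conjugation on \<open>semidihedral\<close> and from counting points. The witness is multiplication
  by a suitable \<open>w\<close>.\<close>

lemma normaliser_semidihedral_involution:
  assumes y: "bij y" and norm: "\<And>q. q \<in> semidihedral \<Longrightarrow> \<exists>q'\<in>semidihedral. q \<circ> y = y \<circ> q'"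
    and sq: "y \<circ> y \<in> semidihedral"
  shows "\<exists>q\<in>semidihedral. (y \<circ> q) \<circ> (y \<circ> q) = id"
proof -
  have inj: "y u = y v \<longleftrightarrow> u = v" for u v
    using y by (simp add: bij_def inj_eq)
  let ?\<nu> = "gauss_mult (-1, 0) :: 'a \<times> 'a \<Rightarrow> 'a \<times> 'a"
  have \<nu>_fix: "?\<nu> v = v \<longleftrightarrow> v = (0, 0)" for v
    using minus_neq_self by (cases v) auto
  have \<nu>\<nu>: "?\<nu> (?\<nu> v) = v" for v
    by (cases v) simp
  have fix0: "q (0, 0) = (0, 0)" if "q \<in> semidihedral" for q
    using that by (cases rule: semidihedral_cases) simp_all
  have conj_invol: "q' (q' v) = v" if "\<And>v. q (q v) = v" "\<And>v. q (y v) = y (q' v)" for q q' v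
    using that inj by metis

  have "?\<nu> \<in> semidihedral"
    using minus_1_two_part by (rule rotation_in_semidihedral) simp
  then obtain n where n: "n \<in> semidihedral" and "?\<nu> \<circ> y = y \<circ> n"
    using norm by blast
  then have yn: "?\<nu> (y v) = y (n v)" for v
    by (metis comp_apply)
  have y0: "y (0, 0) = (0, 0)"
    using yn[of "(0, 0)"] fix0[OF n] \<nu>_fix by simp
  have n_fix: "n v = v \<Longrightarrow> v = (0, 0)" for v
    using yn[of v] \<nu>_fix y0 inj by metis
  \<comment> \<open>Negation fixes only the origin, and so does its conjugate \<open>n\<close>.
    Among the elements of square 1, the identity and the reflections fix a nonzero vector, which
    leaves only negation.\<close>
  have n_eq: "n v = ?\<nu> v" for v
    using n conj_invol[OF \<nu>\<nu> yn]
  proof (cases rule: involution_semidihedral_cases)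
    case 1
    then show ?thesis
      using n_fix[of "(1, 0)"] by simp
  next
    case (3 u w)
    then show ?thesis
      using n_fix[of w] by (simp add: two_part_def)
  qed
  have y\<nu>: "?\<nu> (y v) = y (?\<nu> v)" for v
    using yn n_eq by simp

  have "gauss_cnj \<in> semidihedral"
    by (rule reflection_in_semidihedral[OF one_two_part]) simp
  then obtain t where t: "t \<in> semidihedral" and "gauss_cnj \<circ> y = y \<circ> t"
    using norm by blast
  then have yt: "gauss_cnj (y v) = y (t v)" for v
    by (metis comp_apply)
  \<comment> \<open>The conjugate \<open>t\<close> of \<open>gauss_cnj\<close> is not the identity,
    since \<open>gauss_cnj\<close> moves \<open>i\<close>. It is not negation either:
    \<open>y\<close> commutes with negation, and \<open>gauss_cnj\<close> fixes 1. So it is a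
    reflection.\<close>
  obtain u w where u: "u \<in> two_part" and w: "w \<in> two_part" "gauss_mult u (gauss_cnj w) = w"
    and tu: "\<And>v. t v = gauss_mult u (gauss_cnj v)"
    using t conj_invol[OF gauss_cnj_cnj yt]
  proof (cases rule: involution_semidihedral_cases)
    case 1
    obtain v where "y v = (0, 1)"
      using y by (metis bij_pointE)
    then show ?thesis
      using yt[of v] 1 minus_neq_self[of 1] by simp
  next
    case 2
    obtain v where v: "y v = (1, 0)"
      using y by (metis bij_pointE)
    then have "gauss_cnj (y v) = y v"
      by simp
    then have "?\<nu> (y v) = y v"
      using yt 2 y\<nu> by metis
    then show ?thesis
      using v \<nu>_fix[of "y v"] by simp
  next
    case (3 u w)
    then show ?thesis
      using that by blast
  qed

  \<comment> \<open>Multiplication by \<open>w\<close> undoes the passage from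
    \<open>gauss_cnj\<close> to \<open>t\<close>, so that \<open>z\<close> commutes with both
    conjugation and negation.\<close>
  define z where "z v = y (gauss_mult w v)" for v
  have w0: "w \<noteq> (0, 0)"
    using w by (simp add: two_part_def)
  have rot: "gauss_mult w \<in> semidihedral"
    using w(1) by (rule rotation_in_semidihedral) simp
  have z_cnj: "gauss_cnj (z v) = z (gauss_cnj v)" for v
  proof -
    have "gauss_cnj (z v) = y (gauss_mult (gauss_mult u (gauss_cnj w)) (gauss_cnj v))"
      by (simp add: z_def yt tu gauss_cnj_mult gauss_mult_assoc)
    then show ?thesis
      by (simp add: w(2) z_def)
  qed
  have z_\<nu>: "?\<nu> (z v) = z (?\<nu> v)" for v
    unfolding z_def y\<nu> by (simp only: gauss_mult_left_commute)
  have z_zero: "z v = (0, 0) \<longleftrightarrow> v = (0, 0)" for v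
    using y0 inj[of "gauss_mult w v" "(0, 0)"] gauss_mult_eq_0_iff w0 by (simp add: z_def)
  obtain s where s: "s \<in> semidihedral" "\<And>v. z (z v) = s v"
  proof -
    \<comment> \<open>Moving the inner multiplication by \<open>w\<close> past \<open>y\<close>
      shows that the square of \<open>z\<close> still lies in \<open>semidihedral\<close>.\<close>
    obtain q' where q': "q' \<in> semidihedral" "gauss_mult w \<circ> y = y \<circ> q'"
      using norm[OF rot] by blast
    have "z (z v) = ((y \<circ> y) \<circ> (q' \<circ> gauss_mult w)) v" for v
      using q'(2) by (simp add: z_def) (metis comp_apply)
    then show ?thesis
      using that comp_semidihedral sq q'(1) rot by blast
  qed
  have "s = id"
  proof (rule ccontr)
    assume s_id: "s \<noteq> id"
    \<comment> \<open>The value of \<open>s\<close> at 1 is its factor, which is therefore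
      self-conjugate and equal to 1 or -1.\<close>
    have s_cnj: "gauss_cnj (s (1, 0)) = s (1, 0)"
      using z_cnj s(2) by (metis gauss_cnj.simps minus_zero)
    \<comment> \<open>On a line \<open>j\<close> preserved by \<open>z\<close>, a square equal to
      negation would give orbits of length four on its \<open>q - 1\<close> nonzero points.\<close>
    have no_quarter_turn: False
      if "\<And>a. a \<noteq> 0 \<Longrightarrow> z (z (j a)) = ?\<nu> (j a)" "\<And>a. a \<noteq> 0 \<Longrightarrow> z (j a) \<in> j ` (UNIV - {0})"
        "inj j" "\<And>a. a \<noteq> 0 \<Longrightarrow> j a \<noteq> (0, 0)" for j :: "'a \<Rightarrow> 'a \<times> 'a"
    proof -
      have "4 dvd card (j ` (UNIV - {0}))"
      proof (rule four_dvd_card_if_square_no_fixpoint[where f = z])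
        fix x assume "x \<in> j ` (UNIV - {0})"
        then obtain a where a: "a \<noteq> 0" "x = j a"
          by blast
        show "z x \<in> j ` (UNIV - {0})"
          using that(2) a by simp
        show "z (z (z (z x))) = x"
          using that(1)[OF a(1)] a(2) z_\<nu> \<nu>\<nu> by metis
        show "z (z x) \<noteq> x"
          using that(1,4)[OF a(1)] a(2) \<nu>_fix by metis
      qed simp
      then show False
        using card_image[OF inj_on_subset[OF that(3), of "UNIV - {0}"]] card_nonzero
          not_four_dvd_card_minus_1 by simp
    qed
    have z_real: "z (a, 0) \<in> (\<lambda>a. (a, 0)) ` (UNIV - {0})" if a: "a \<noteq> 0" for a
    proof -
      obtain b c where bc: "z (a, 0) = (b, c)"
        by (cases "z (a, 0)")
      have "- c = c"
        using z_cnj[of "(a, 0)"] bc by simp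
      then have "c = 0"
        using minus_neq_self by blast
      then show ?thesis
        using bc z_zero[of "(a, 0)"] a by auto
    qed
    \<comment> \<open>The imaginary line consists of the fixed points of negation composed with
      conjugation, and \<open>z\<close> commutes with this composite.\<close>
    have z_imag: "z (0, a) \<in> Pair 0 ` (UNIV - {0})" if a: "a \<noteq> 0" for a
    proof -
      obtain b c where bc: "z (0, a) = (b, c)"
        by (cases "z (0, a)")
      have "z (0, a) = z (?\<nu> (gauss_cnj (0, a)))"
        by simp
      also have "\<dots> = ?\<nu> (gauss_cnj (z (0, a)))"
        by (simp only: z_cnj z_\<nu>)
      finally have "- b = b"
        using bc by simp
      then have "b = 0"
        using minus_neq_self by blast
      then show ?thesis
        using bc z_zero[of "(0, a)"] a by auto
    qed
    have inj_real: "inj (\<lambda>a :: 'a. (a, 0 :: 'a))" and inj_imag: "inj (Pair (0 :: 'a) :: 'a \<Rightarrow> _)"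
      by (auto simp: inj_def)
    from s(1) show False
    proof (cases rule: semidihedral_cases)
      case f: (rotation f)
      have "f = (1, 0) \<or> f = (-1, 0)"
        using two_part_self_conjugate[OF f(1)] s_cnj f(2) by simp
      moreover have "f \<noteq> (1, 0)"
        using s_id f(2) by (auto simp: fun_eq_iff)
      ultimately have "f = (-1, 0)" by blast
      then show False
        by (intro no_quarter_turn[of "\<lambda>a. (a, 0)"] z_real inj_real) (simp_all add: s f)
    next
      case f: (reflection f)
      have "f = (1, 0) \<or> f = (-1, 0)"
        using two_part_self_conjugate[OF f(1)] s_cnj f(2) by simp
      \<comment> \<open>A reflection with factor -1 negates the real line; one with factor 1 fixes
        that line pointwise but negates the imaginary one.\<close>
      then show False
      proof
        assume "f = (-1, 0)"
        then show False
          by (intro no_quarter_turn[of "\<lambda>a. (a, 0)"] z_real inj_real) (simp_all add: s f)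
      next
        assume "f = (1, 0)"
        then show False
          by (intro no_quarter_turn[of "Pair 0"] z_imag inj_imag) (simp_all add: s f)
      qed
    qed
  qed
  then have "(y \<circ> gauss_mult w) \<circ> (y \<circ> gauss_mult w) = id"
    using s(2) by (auto simp: fun_eq_iff z_def)
  then show ?thesis
    using rot by blast
qed

lemma AGL2_perfect_code:
  "is_perfect_code_of (BijGroup UNIV) (AGL2 :: ('a \<times> 'a \<Rightarrow> 'a \<times> 'a) set)"
proof -
  let ?G = "BijGroup (UNIV :: ('a \<times> 'a) set)"
  interpret G: group ?G
    by (rule group_BijGroup)
  have bij: "bij q" if "q \<in> semidihedral" for q
    using subgroup.mem_carrier[OF subgroup_semidihedral that] by (simp add: bij_carrier_BijGroup_UNIV)
  obtain m where m: "card (AGL2 :: ('a \<times> 'a \<Rightarrow> 'a \<times> 'a) set) = card semidihedral * m" "odd m"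
    by (rule odd_index_semidihedral)
  show ?thesis
  proof (rule G.perfect_code_if_sylow_normaliser_involutions[OF subgroup_AGL2 _ subgroup_semidihedral
        semidihedral_subset_AGL2 card_semidihedral m])
    show "finite (carrier ?G)"
      by (rule finite)
    fix y assume y: "y \<in> carrier ?G" and coset: "y <#\<^bsub>?G\<^esub> semidihedral = semidihedral #>\<^bsub>?G\<^esub> y"
      and sq: "y \<otimes>\<^bsub>?G\<^esub> y \<in> semidihedral"
    have yb: "bij y"
      using y by (simp add: bij_carrier_BijGroup_UNIV)
    have "\<exists>q'\<in>semidihedral. q \<circ> y = y \<circ> q'" if q: "q \<in> semidihedral" for q
    proof -
      have "q \<otimes>\<^bsub>?G\<^esub> y \<in> y <#\<^bsub>?G\<^esub> semidihedral"
        unfolding coset using q by (auto simp: r_coset_def)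
      then obtain q' where "q' \<in> semidihedral" "q \<otimes>\<^bsub>?G\<^esub> y = y \<otimes>\<^bsub>?G\<^esub> q'"
        by (auto simp: l_coset_def)
      then show ?thesis
        using q yb bij by (auto simp: mult_BijGroup_UNIV)
    qed
    then obtain q where "q \<in> semidihedral" "(y \<circ> q) \<circ> (y \<circ> q) = id"
      using normaliser_semidihedral_involution[OF yb] sq yb by (auto simp: mult_BijGroup_UNIV)
    then show "\<exists>q\<in>semidihedral. (y \<otimes>\<^bsub>?G\<^esub> q) \<otimes>\<^bsub>?G\<^esub> (y \<otimes>\<^bsub>?G\<^esub> q) = \<one>\<^bsub>?G\<^esub>"
      using yb bij by (auto simp: mult_BijGroup_UNIV one_BijGroup_UNIV bij_comp)
  qed
qed

end

theorem theorem1p7: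
  assumes "card (UNIV :: 'a::{field, finite} set) mod 4 = 3"
  shows "is_perfect_code_of (BijGroup (UNIV :: ('a \<times> 'a) set))
           (AGL2 :: (('a \<times> 'a) \<Rightarrow> ('a \<times> 'a)) set)"
proof -
  interpret three_mod_four_field "TYPE('a)"
    using assms by unfold_locales
  show ?thesis
    by (rule AGL2_perfect_code)
qed

end
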